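(* Let $X$ be a Banach space with an unconditional basis $(e_n)_{n=1}^\infty$, let $(a_{kn})_{k,n=1}^\infty$ be a Köthe matrix with $a_{kn}>0$ for all $k$ and $n$, let $(E_n,q_n)_{n=1}^\infty$ be a sequence of Banach spaces, and let $E$ be the corresponding vector valued $X$-Köthe sequence space, with $(p_k)_{k=1}^\infty$ as in its definition. Then an arbitrary bounded set $B\subset E$ is contained in a bounded set of the form $$B_0=\Big\{x : \Big\|\sum_{n=1}^\infty b_nq_n(x_n)e_n\Big\|_X\le1\Big\}$$ for some positive sequence $(b_n)_{n=1}^\infty$. Moreover, $E_{B_0}$ is isometric to the spaces $E_{p_k}$.
   Context: A Köthe matrix is a matrix $(a_{kn})_{k,n=1}^\infty$ of non-negative numbers such that $a_{k+1,n}\ge a_{kn}$ for all $k,n$ and such that for every $n$ there is $k$ with $a_{kn}>0$. Here $q_n$ is the norm of the Banach space $E_n$. The vector valued $X$-Köthe sequence space is $$E=\Big\{x=(x_n)_{n=1}^\infty : x_n\in E_n,\ p_k(x):=\Big\|\sum_{n=1}^\infty a_{kn}q_n(x_n)e_n\Big\|_X<\infty\ \text{for all }k\Big\},$$ considered as a Fréchet space with the topology defined by $(p_k)_{k=1}^\infty$. In the definition of $B_0$, $x=(x_n)_{n=1}^\infty$ denotes an element of $E$. $E_{p_k}$ denotes the local Banach space, i.e. the completion of the normed space $(E/\ker p_k,p_k)$. $E_{B_0}$ is the linear span of $B_0$ normed by the Minkowski functional of $B_0$. *)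

theory Defs
  imports "HOL-Analysis.Analysis" "HOL-Library.Function_Algebras"
begin

text \<open>
  The scalars form an arbitrary type of class \<^class>\<open>real_normed_field\<close>. By the theorem of
  Gelfand and Mazur the only such fields are the reals and the complex numbers, so real and
  complex Banach spaces are treated simultaneously.
\<close>


section \<open>Banach spaces and unconditional bases\<close>

text \<open>The space \<open>X\<close> is a type of class \<^class>\<open>banach\<close> with a compatible scalar multiplication:\<close>

definition normed_scaling :: "('k::real_normed_field \<Rightarrow> 'x::real_normed_vector \<Rightarrow> 'x) \<Rightarrow> bool" where
  "normed_scaling s \<longleftrightarrow> vector_space s \<and> (\<forall>c x. norm (s c x) = norm c * norm x) \<and>
     (\<forall>r x. s (of_real r) x = r *\<^sub>R x)"

text \<open>
  The spaces \<open>E\<^sub>n\<close> differ from one another, so they are subspaces of one vector space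
  (without topology), each with a complete norm of its own. This is no restriction: any
  sequence of vector spaces embeds into its product.
\<close>

definition normed_space_on ::
    "('k::real_normed_field \<Rightarrow> 'b::ab_group_add \<Rightarrow> 'b) \<Rightarrow> 'b set \<Rightarrow> ('b \<Rightarrow> real) \<Rightarrow> bool" where
  "normed_space_on s S q \<longleftrightarrow> module.subspace s S \<and>
     (\<forall>x\<in>S. 0 \<le> q x \<and> (q x = 0 \<longleftrightarrow> x = 0)) \<and>
     (\<forall>x\<in>S. \<forall>y\<in>S. q (x + y) \<le> q x + q y) \<and>
     (\<forall>c. \<forall>x\<in>S. q (s c x) = norm c * q x)"

definition banach_space_on ::
    "('k::real_normed_field \<Rightarrow> 'b::ab_group_add \<Rightarrow> 'b) \<Rightarrow> 'b set \<Rightarrow> ('b \<Rightarrow> real) \<Rightarrow> bool" where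
  "banach_space_on s S q \<longleftrightarrow> normed_space_on s S q \<and>
     (\<forall>f. (\<forall>i. f i \<in> S) \<and> (\<forall>\<epsilon>>0. \<exists>N. \<forall>i\<ge>N. \<forall>j\<ge>N. q (f i - f j) < \<epsilon>) \<longrightarrow>
        (\<exists>l\<in>S. (\<lambda>i. q (f i - l)) \<longlonglongrightarrow> (0::real)))"

definition schauder_basis ::
    "('k::real_normed_field \<Rightarrow> 'x::real_normed_vector \<Rightarrow> 'x) \<Rightarrow> (nat \<Rightarrow> 'x) \<Rightarrow> bool" where
  "schauder_basis s e \<longleftrightarrow> (\<forall>x. \<exists>!c. (\<lambda>n. s (c n) (e n)) sums x)"

text \<open>\<^const>\<open>summable_on\<close> over \<^const>\<open>UNIV\<close> is unconditional convergence.\<close>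

definition unconditional_basis ::
    "('k::real_normed_field \<Rightarrow> 'x::real_normed_vector \<Rightarrow> 'x) \<Rightarrow> (nat \<Rightarrow> 'x) \<Rightarrow> bool" where
  "unconditional_basis s e \<longleftrightarrow> schauder_basis s e \<and>
     (\<forall>c. summable (\<lambda>n. s (c n) (e n)) \<longrightarrow> (\<lambda>n. s (c n) (e n)) summable_on UNIV)"


section \<open>Vector valued Koethe sequence spaces\<close>

definition koethe_matrix :: "(nat \<Rightarrow> nat \<Rightarrow> real) \<Rightarrow> bool" where
  "koethe_matrix a \<longleftrightarrow> (\<forall>k n. 0 \<le> a k n) \<and> (\<forall>k n. a k n \<le> a (Suc k) n) \<and> (\<forall>n. \<exists>k. 0 < a k n)"

definition weighted_series ::
    "(nat \<Rightarrow> 'x::real_normed_vector) \<Rightarrow> (nat \<Rightarrow> 'b \<Rightarrow> real) \<Rightarrow> (nat \<Rightarrow> real) \<Rightarrow> (nat \<Rightarrow> 'b) \<Rightarrow> nat \<Rightarrow> 'x" where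
  "weighted_series e q w x = (\<lambda>n. (w n * q n (x n)) *\<^sub>R e n)"

text \<open>
  \<open>\<parallel>\<Sum>\<^sub>n w\<^sub>n q\<^sub>n(x\<^sub>n) e\<^sub>n\<parallel>\<close>; as \<^const>\<open>suminf\<close> is total, the value is meaningful only if the series
  converges. Below, finiteness of this norm is rendered as convergence of the series in \<open>X\<close>.
\<close>

definition weighted_norm ::
    "(nat \<Rightarrow> 'x::real_normed_vector) \<Rightarrow> (nat \<Rightarrow> 'b \<Rightarrow> real) \<Rightarrow> (nat \<Rightarrow> real) \<Rightarrow> (nat \<Rightarrow> 'b) \<Rightarrow> real" where
  "weighted_norm e q w x = norm (\<Sum>n. weighted_series e q w x n)"

definition koethe_space ::
    "(nat \<Rightarrow> 'x::real_normed_vector) \<Rightarrow> (nat \<Rightarrow> nat \<Rightarrow> real) \<Rightarrow> (nat \<Rightarrow> 'b set) \<Rightarrow> (nat \<Rightarrow> 'b \<Rightarrow> real)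
       \<Rightarrow> (nat \<Rightarrow> 'b) set" where
  "koethe_space e a E q =
     {x. (\<forall>n. x n \<in> E n) \<and> (\<forall>k. summable (weighted_series e q (a k) x))}"

definition seq_scale :: "('k \<Rightarrow> 'b \<Rightarrow> 'b) \<Rightarrow> 'k \<Rightarrow> (nat \<Rightarrow> 'b) \<Rightarrow> (nat \<Rightarrow> 'b)" where
  "seq_scale s c x = (\<lambda>n. s c (x n))"

definition koethe_topology ::
    "(nat \<Rightarrow> 'x::real_normed_vector) \<Rightarrow> (nat \<Rightarrow> nat \<Rightarrow> real) \<Rightarrow> (nat \<Rightarrow> 'b::ab_group_add set)
       \<Rightarrow> (nat \<Rightarrow> 'b \<Rightarrow> real) \<Rightarrow> (nat \<Rightarrow> 'b) topology" where
  "koethe_topology e a E q = topology (\<lambda>U. U \<subseteq> koethe_space e a E q \<and>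
     (\<forall>x\<in>U. \<exists>\<epsilon>>0. \<exists>m. \<forall>y\<in>koethe_space e a E q.
        (\<forall>k\<le>m. weighted_norm e q (a k) (y - x) < \<epsilon>) \<longrightarrow> y \<in> U))"

lemma openin_koethe_topology:
  "openin (koethe_topology e a E q) U \<longleftrightarrow> U \<subseteq> koethe_space e a E q \<and>
     (\<forall>x\<in>U. \<exists>\<epsilon>>0. \<exists>m. \<forall>y\<in>koethe_space e a E q.
        (\<forall>k\<le>m. weighted_norm e q (a k) (y - x) < \<epsilon>) \<longrightarrow> y \<in> U)"
proof -
  let ?E = "koethe_space e a E q"
  let ?near = "\<lambda>x \<epsilon> m y. \<forall>k\<le>(m::nat). weighted_norm e q (a k) (y - x) < (\<epsilon>::real)"
  let ?O = "\<lambda>U. U \<subseteq> ?E \<and> (\<forall>x\<in>U. \<exists>\<epsilon>>0. \<exists>m. \<forall>y\<in>?E. ?near x \<epsilon> m y \<longrightarrow> y \<in> U)"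
  have "istopology ?O"
    unfolding istopology_def
  proof (rule conjI; intro allI impI)
    fix U V assume U: "?O U" and V: "?O V"
    have "\<exists>\<epsilon>>0. \<exists>m. \<forall>y\<in>?E. ?near x \<epsilon> m y \<longrightarrow> y \<in> U \<inter> V" if x: "x \<in> U \<inter> V" for x
    proof -
      obtain \<epsilon> m where 1: "\<epsilon> > 0" "\<forall>y\<in>?E. ?near x \<epsilon> m y \<longrightarrow> y \<in> U" using U x by blast
      obtain \<delta> l where 2: "\<delta> > 0" "\<forall>y\<in>?E. ?near x \<delta> l y \<longrightarrow> y \<in> V" using V x by blast
      have "\<forall>y\<in>?E. ?near x (min \<epsilon> \<delta>) (max m l) y \<longrightarrow> y \<in> U \<inter> V"
        using 1 2 by (auto simp: le_max_iff_disj)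
      moreover have "min \<epsilon> \<delta> > 0" using 1 2 by simp
      ultimately show ?thesis by blast
    qed
    then show "?O (U \<inter> V)" using U by blast
  next
    fix K assume K: "\<forall>U\<in>K. ?O U"
    have "\<exists>\<epsilon>>0. \<exists>m. \<forall>y\<in>?E. ?near x \<epsilon> m y \<longrightarrow> y \<in> \<Union>K" if x: "x \<in> \<Union>K" for x
    proof -
      obtain U where U: "U \<in> K" "x \<in> U" using x by blast
      then obtain \<epsilon> m where "\<epsilon> > 0" "\<forall>y\<in>?E. ?near x \<epsilon> m y \<longrightarrow> y \<in> U" using K by blast
      then show ?thesis using U by blast
    qed
    then show "?O (\<Union>K)" using K by blast
  qed
  then show ?thesis
    unfolding koethe_topology_def by (simp add: topology_inverse')
qed

definition bounded_wrt ::
    "('k::real_normed_field \<Rightarrow> 'v::zero \<Rightarrow> 'v) \<Rightarrow> 'v topology \<Rightarrow> 'v set \<Rightarrow> bool" where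
  "bounded_wrt s T B \<longleftrightarrow> B \<subseteq> topspace T \<and>
     (\<forall>U. openin T U \<and> 0 \<in> U \<longrightarrow> (\<exists>r>0. \<forall>t>r. B \<subseteq> s (of_real t) ` U))"

definition koethe_ball ::
    "(nat \<Rightarrow> 'x::real_normed_vector) \<Rightarrow> (nat \<Rightarrow> nat \<Rightarrow> real) \<Rightarrow> (nat \<Rightarrow> 'b set) \<Rightarrow> (nat \<Rightarrow> 'b \<Rightarrow> real)
       \<Rightarrow> (nat \<Rightarrow> real) \<Rightarrow> (nat \<Rightarrow> 'b) set" where
  "koethe_ball e a E q b =
     {x \<in> koethe_space e a E q. summable (weighted_series e q b x) \<and> weighted_norm e q b x \<le> 1}"


section \<open>Local Banach spaces and isometry\<close>

record ('k, 'v) seminormed_space =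
  pts :: "'v set"
  vadd :: "'v \<Rightarrow> 'v \<Rightarrow> 'v"
  vscale :: "'k \<Rightarrow> 'v \<Rightarrow> 'v"
  vnorm :: "'v \<Rightarrow> real"

definition vdiff :: "('k::real_normed_field, 'v) seminormed_space \<Rightarrow> 'v \<Rightarrow> 'v \<Rightarrow> 'v" where
  "vdiff S x y = vadd S x (vscale S (-1) y)"

definition ker_rel :: "('k::real_normed_field, 'v) seminormed_space \<Rightarrow> 'v rel" where
  "ker_rel S = {(x, y). x \<in> pts S \<and> y \<in> pts S \<and> vnorm S (vdiff S x y) = 0}"

definition kernel_quotient ::
    "('k::real_normed_field, 'v) seminormed_space \<Rightarrow> ('k, 'v set) seminormed_space" where
  "kernel_quotient S =
     \<lparr> pts = pts S // ker_rel S,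
       vadd = (\<lambda>A B. \<Union>x\<in>A. \<Union>y\<in>B. ker_rel S `` {vadd S x y}),
       vscale = (\<lambda>c A. \<Union>x\<in>A. ker_rel S `` {vscale S c x}),
       vnorm = (\<lambda>A. the_elem (vnorm S ` A)) \<rparr>"

definition cauchy_sequences ::
    "('k::real_normed_field, 'v) seminormed_space \<Rightarrow> ('k, nat \<Rightarrow> 'v) seminormed_space" where
  "cauchy_sequences S =
     \<lparr> pts = {f. (\<forall>i. f i \<in> pts S) \<and>
               (\<forall>\<epsilon>>0. \<exists>N. \<forall>i\<ge>N. \<forall>j\<ge>N. vnorm S (vdiff S (f i) (f j)) < \<epsilon>)},
       vadd = (\<lambda>f g i. vadd S (f i) (g i)),
       vscale = (\<lambda>c f i. vscale S c (f i)),
       vnorm = (\<lambda>f. lim (\<lambda>i. vnorm S (f i))) \<rparr>"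

text \<open>The kernel of the limit seminorm consists of the null sequences.\<close>

definition completion ::
    "('k::real_normed_field, 'v) seminormed_space \<Rightarrow> ('k, (nat \<Rightarrow> 'v) set) seminormed_space" where
  "completion S = kernel_quotient (cauchy_sequences S)"

definition koethe_seminormed ::
    "('k::real_normed_field \<Rightarrow> 'b::ab_group_add \<Rightarrow> 'b) \<Rightarrow> (nat \<Rightarrow> 'x::real_normed_vector)
       \<Rightarrow> (nat \<Rightarrow> nat \<Rightarrow> real) \<Rightarrow> (nat \<Rightarrow> 'b set) \<Rightarrow> (nat \<Rightarrow> 'b \<Rightarrow> real) \<Rightarrow> nat
       \<Rightarrow> ('k, nat \<Rightarrow> 'b) seminormed_space" where
  "koethe_seminormed s e a E q k =
     \<lparr> pts = koethe_space e a E q, vadd = (+), vscale = seq_scale s,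
       vnorm = weighted_norm e q (a k) \<rparr>"

definition local_banach_space ::
    "('k::real_normed_field \<Rightarrow> 'b::ab_group_add \<Rightarrow> 'b) \<Rightarrow> (nat \<Rightarrow> 'x::real_normed_vector)
       \<Rightarrow> (nat \<Rightarrow> nat \<Rightarrow> real) \<Rightarrow> (nat \<Rightarrow> 'b set) \<Rightarrow> (nat \<Rightarrow> 'b \<Rightarrow> real) \<Rightarrow> nat
       \<Rightarrow> ('k, (nat \<Rightarrow> (nat \<Rightarrow> 'b) set) set) seminormed_space" where
  "local_banach_space s e a E q k = completion (kernel_quotient (koethe_seminormed s e a E q k))"

definition minkowski :: "('k::real_normed_field \<Rightarrow> 'v \<Rightarrow> 'v) \<Rightarrow> 'v set \<Rightarrow> 'v \<Rightarrow> real" where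
  "minkowski s B x = Inf {t. 0 < t \<and> x \<in> s (of_real t) ` B}"

definition span_space ::
    "('k::real_normed_field \<Rightarrow> 'v::ab_group_add \<Rightarrow> 'v) \<Rightarrow> 'v set \<Rightarrow> ('k, 'v) seminormed_space" where
  "span_space s B =
     \<lparr> pts = module.span s B, vadd = (+), vscale = s, vnorm = minkowski s B \<rparr>"

definition isometric ::
    "('k, 'v) seminormed_space \<Rightarrow> ('k, 'w) seminormed_space \<Rightarrow> bool" where
  "isometric S T \<longleftrightarrow> (\<exists>f. bij_betw f (pts S) (pts T) \<and>
     (\<forall>x\<in>pts S. \<forall>y\<in>pts S. f (vadd S x y) = vadd T (f x) (f y)) \<and>
     (\<forall>c. \<forall>x\<in>pts S. f (vscale S c x) = vscale T c (f x)) \<and>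
     (\<forall>x\<in>pts S. vnorm T (f x) = vnorm S x))"

end

theory Submission
  imports Defs
begin

text \<open>
  The norm of \<open>X\<close> need not be monotone in the coefficients, but an unconditional basis has an
  unconditional constant \<open>C\<close>: if \<open>\<bar>u\<^sub>n\<bar> \<le> \<bar>v\<^sub>n\<bar>\<close> for real coefficients and \<open>\<Sum> v\<^sub>n e\<^sub>n\<close> converges, then
  \<open>\<Sum> u\<^sub>n e\<^sub>n\<close> converges and its norm is at most \<open>C\<close> times that of \<open>\<Sum> v\<^sub>n e\<^sub>n\<close>
  (\<open>solid_norm_constant\<close>). This weak form of monotonicity carries the whole argument, although the
  functions \<open>p\<^sub>k\<close> are then only quasi-seminorms: from \<open>\<bar>q\<^sub>n(x\<^sub>n) - q\<^sub>n(y\<^sub>n)\<bar> \<le> q\<^sub>n(x\<^sub>n - y\<^sub>n)\<close> one still gets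
  \<open>\<bar>p\<^sub>k(x) - p\<^sub>k(y)\<bar> \<le> C p\<^sub>k(x - y)\<close>. Hence \<open>p\<^sub>k\<close> is continuous, its unit ball is open, and it extends to
  the completion.

  The constant exists because the sets of vectors whose finite partial expansions are bounded by
  \<open>m\<close> cover \<open>X\<close>; by Baire's theorem the closure of one of them contains a ball, and successive
  approximation removes the closure. The last step needs limits of coordinates, hence completeness
  of the scalar field. This is a form of the Gelfand-Mazur theorem
  (\<open>real_normed_field_Cauchy_convergent\<close>): every element of the field is a root of a real quadratic
  polynomial of non-positive discriminant, so that the field has dimension at most two over the reals.

  A set \<open>B\<close> is bounded iff every \<open>p\<^sub>k\<close> is bounded on it, by \<open>M\<^sub>k\<close> say. With positive \<open>c\<^sub>k\<close> small enough,
  \<open>b\<^sub>n = \<Sum>\<^sub>k c\<^sub>k a\<^sub>k\<^sub>n\<close> converges for each \<open>n\<close> and \<open>\<Sum>\<^sub>k c\<^sub>k M\<^sub>k \<le> 1\<close>. For \<open>x \<in> B\<close> the vector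
  \<open>\<Sum>\<^sub>n b\<^sub>n q\<^sub>n(x\<^sub>n) e\<^sub>n\<close> is the absolutely convergent sum of \<open>c\<^sub>k \<Sum>\<^sub>n a\<^sub>k\<^sub>n q\<^sub>n(x\<^sub>n) e\<^sub>n\<close>, so its norm is at most one,
  and \<open>c\<^sub>k a\<^sub>k\<^sub>n \<le> b\<^sub>n\<close> gives \<open>p\<^sub>k \<le> C / c\<^sub>k\<close> on the ball of \<open>b\<close> (\<open>bounded_subset_koethe_ball\<close>).

  For a positive weight \<open>w\<close> let \<open>\<ell>(w)\<close> be the space of all \<open>x\<close> with \<open>x\<^sub>n \<in> E\<^sub>n\<close> for which
  \<open>\<Sum> w\<^sub>n q\<^sub>n(x\<^sub>n) e\<^sub>n\<close> converges, with the norm of this sum as \<open>p\<^sub>w(x)\<close>. It is complete, and the finitely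
  supported sequences are dense in it, so the completion of the Koethe space under \<open>p\<^sub>k\<close> is \<open>\<ell>(a\<^sub>k)\<close>.
  If the ball of \<open>b\<close> is bounded, testing it on sequences with one entry shows that \<open>\<ell>(b)\<close> lies in the
  Koethe space; hence \<open>\<ell>(b)\<close> is the span of the ball and \<open>p\<^sub>b\<close> its Minkowski functional. Finally
  multiplication of the \<open>n\<close>-th coordinate by \<open>b\<^sub>n / a\<^sub>k\<^sub>n\<close> is an isometry of \<open>\<ell>(b)\<close> onto \<open>\<ell>(a\<^sub>k)\<close>.
\<close>

section \<open>Completeness of the scalar field\<close>

lemma complete_of_real_image: "complete (range (of_real :: real \<Rightarrow> 'k::real_normed_field))"
proof (rule completeI)
  fix f :: "nat \<Rightarrow> 'k" assume f: "\<forall>n. f n \<in> range of_real" "Cauchy f"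
  then have "\<forall>n. \<exists>r. f n = of_real r" by blast
  then obtain g where g: "\<And>n. f n = of_real (g n)" using choice[of "\<lambda>n r. f n = of_real r"] by blast
  have "Cauchy g" using f(2) unfolding Cauchy_def dist_norm g of_real_diff[symmetric] norm_of_real
    by (simp add: real_norm_def)
  then obtain l where "g \<longlonglongrightarrow> l" using Cauchy_convergent[of g] by (auto simp: convergent_def)
  then have "f \<longlonglongrightarrow> of_real l" unfolding g[abs_def] by (rule tendsto_of_real)
  then show "\<exists>l\<in>range of_real. f \<longlonglongrightarrow> l" by blast
qed

text \<open>
  Since the reals are closed in the field, \<open>x\<close> has positive distance from them. So both coefficients
  of \<open>a x + b\<close> are controlled by its norm, and coefficientwise convergence can be read off from norms.
\<close>

lemma real_plane_norm_bound:
  fixes x :: "'k::real_normed_field"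
  assumes "x \<notin> range of_real"
  shows "\<exists>\<delta>>0. \<forall>a b. \<delta> * \<bar>a\<bar> \<le> norm (of_real a * x + of_real b) \<and> \<delta> * \<bar>b\<bar> \<le> norm (of_real a * x + of_real b)"
proof -
  have "closed (range (of_real :: real \<Rightarrow> 'k))"
    by (rule complete_imp_closed[OF complete_of_real_image])
  then have "open (- range (of_real :: real \<Rightarrow> 'k))" by (rule open_Compl)
  then obtain r where r: "r > 0" "ball x r \<subseteq> - range of_real"
    using assms unfolding open_contains_ball by blast
  have dist: "r \<le> norm (x + of_real b)" for b
  proof (rule ccontr)
    assume "\<not> ?thesis"
    then have "of_real (-b) \<in> ball x r" by (simp add: dist_norm)
    then show False using r(2) by blast
  qed
  have 1: "r * \<bar>a\<bar> \<le> norm (of_real a * x + of_real b)" for a b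
  proof (cases "a = 0")
    case False
    have "of_real a * x + of_real b = of_real a * (x + of_real (b / a))"
      using False by (simp add: field_simps)
    then have "norm (of_real a * x + of_real b) = \<bar>a\<bar> * norm (x + of_real (b / a))"
      by (simp add: norm_mult)
    then show ?thesis using mult_left_mono[OF dist[of "b/a"], of "\<bar>a\<bar>"] by (simp add: mult.commute)
  qed simp
  have 2: "\<bar>b\<bar> \<le> norm (of_real a * x + of_real b) * (1 + norm x / r)" for a b
  proof -
    have "\<bar>b\<bar> = norm ((of_real a * x + of_real b) - of_real a * x)" by simp
    also have "\<dots> \<le> norm (of_real a * x + of_real b) + \<bar>a\<bar> * norm x"
      by (metis norm_mult norm_of_real norm_triangle_ineq4)
    also have "\<bar>a\<bar> * norm x \<le> norm (of_real a * x + of_real b) / r * norm x"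
      using 1[of a b] r(1) by (intro mult_right_mono) (simp_all add: field_simps)
    finally show ?thesis by (simp add: algebra_simps)
  qed
  define \<delta> where "\<delta> = min r (1 / (1 + norm x / r))"
  have pos: "1 + norm x / r > 0" using r(1) by (simp add: add_pos_nonneg)
  have "\<delta> > 0" using r(1) pos by (simp add: \<delta>_def)
  moreover have "\<delta> * \<bar>a\<bar> \<le> norm (of_real a * x + of_real b)" for a b
  proof -
    have "\<delta> * \<bar>a\<bar> \<le> r * \<bar>a\<bar>" by (intro mult_right_mono) (auto simp: \<delta>_def)
    then show ?thesis using 1[of a b] by linarith
  qed
  moreover have "\<delta> * \<bar>b\<bar> \<le> norm (of_real a * x + of_real b)" for a b
  proof -
    have "\<delta> * \<bar>b\<bar> \<le> (1 / (1 + norm x / r)) * \<bar>b\<bar>" by (intro mult_right_mono) (auto simp: \<delta>_def)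
    also have "\<dots> \<le> norm (of_real a * x + of_real b)" using 2[of b a] pos by (simp add: field_simps)
    finally show ?thesis .
  qed
  ultimately show ?thesis by (intro exI[of _ \<delta>] conjI allI)
qed

text \<open>
  This is \<open>(x - z) (x - cnj z)\<close>, written without an imaginary unit because the field need not have one.
\<close>

definition real_quadratic :: "complex \<Rightarrow> 'k::real_normed_field \<Rightarrow> 'k" where
  "real_quadratic z x = (x - of_real (Re z))\<^sup>2 + (of_real (Im z))\<^sup>2"

lemma real_quadratic_expand:
  "real_quadratic z x = x\<^sup>2 + (of_real (- 2 * Re z) * x + of_real ((cmod z)\<^sup>2))"
  unfolding real_quadratic_def cmod_power2 by (simp add: power2_eq_square algebra_simps)

lemma real_quadratic_square:
  fixes y :: "'k::real_normed_field"
  shows "real_quadratic (w\<^sup>2) (y\<^sup>2) = real_quadratic w y * real_quadratic (- w) y"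
proof -
  have "(y\<^sup>2 - (a\<^sup>2 - b\<^sup>2))\<^sup>2 + (2 * a * b)\<^sup>2 = ((y - a)\<^sup>2 + b\<^sup>2) * ((y + a)\<^sup>2 + b\<^sup>2)" for a b :: 'k
    by algebra
  from this[of "of_real (Re w)" "of_real (Im w)"] show ?thesis
    by (simp add: real_quadratic_def Re_power2 Im_power2)
qed

text \<open>
  Factoring \<open>(t - z) (t - cnj z) - w\<close> over the complex numbers gives two roots \<open>Re z \<plusminus> d\<close>, where \<open>d\<close> is
  a square root of \<open>w - (Im z)\<^sup>2\<close>; pairing them with their conjugates gives two real quadratics.
\<close>

lemma real_quadratic_compose:
  fixes x :: "'k::real_normed_field"
  shows "\<exists>t1 t2. real_quadratic w (real_quadratic z x) = real_quadratic t1 x * real_quadratic t2 x"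
proof -
  obtain d where d: "d\<^sup>2 = w - of_real ((Im z)\<^sup>2)" by (metis power2_csqrt)
  have shift: "real_quadratic (of_real r + c) y = real_quadratic c (y - of_real r)" for r c and y :: 'k
    unfolding real_quadratic_def by (simp only: plus_complex.sel Re_complex_of_real Im_complex_of_real of_real_add diff_diff_eq add_0)
  have "real_quadratic w (real_quadratic z x)
      = real_quadratic w (of_real ((Im z)\<^sup>2) + (x - of_real (Re z))\<^sup>2)"
    by (simp add: real_quadratic_def[of z] add.commute)
  also have "\<dots> = real_quadratic (d\<^sup>2) ((x - of_real (Re z))\<^sup>2)"
    using shift[of "(Im z)\<^sup>2" "d\<^sup>2" "of_real ((Im z)\<^sup>2) + (x - of_real (Re z))\<^sup>2"]
    unfolding d add_diff_cancel_left' by (simp only: add_diff_eq add_diff_cancel_left')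
  also have "\<dots> = real_quadratic (of_real (Re z) + d) x * real_quadratic (of_real (Re z) + - d) x"
    unfolding real_quadratic_square shift ..
  finally show ?thesis by blast
qed

lemma power_two_power_diff:
  fixes y c :: "'a::comm_ring_1"
  shows "y ^ (2 ^ j) - c ^ (2 ^ j) = (y - c) * (\<Prod>i<j. y ^ (2 ^ i) + c ^ (2 ^ i))"
proof (induction j)
  case (Suc j)
  have "y ^ (2 ^ Suc j) - c ^ (2 ^ Suc j) = (y ^ (2 ^ j) - c ^ (2 ^ j)) * (y ^ (2 ^ j) + c ^ (2 ^ j))"
    unfolding power_Suc2 power_mult by (simp add: power2_eq_square algebra_simps)
  then show ?case using Suc by (simp add: mult.assoc)
qed simp

text \<open>
  The idea of Ostrowski's proof of Gelfand-Mazur: write \<open>y\<close> for a value of minimal norm \<open>m\<close> and factor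
  \<open>y\<^bsup>2^j\<^esup> - (m/2)\<^bsup>2^j\<^esup>\<close>. The squares of all factors other than \<open>y + m/2\<close> are products of values of
  real quadratics at \<open>x\<close>, so these factors are bounded below by powers of \<open>m\<close>. Comparing with the upper bound
  \<open>m\<^bsup>2^j\<^esup> (1 + (1/2)\<^bsup>2^j\<^esup>)\<close> and letting \<open>j\<close> grow leaves no room for \<open>y + m/2\<close> to exceed \<open>m\<close>.
\<close>

lemma quadratic_minimum_spreads:
  fixes x :: "'k::real_normed_field"
  assumes m: "m > 0" and min: "\<And>t. m \<le> norm (real_quadratic t x)" and z: "norm (real_quadratic z x) = m"
  shows "norm (real_quadratic z x + of_real (m / 2)) \<le> m"
proof -
  define y where "y = real_quadratic z x"
  have y: "norm y = m" using z by (simp add: y_def)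
  have low: "(m ^ (2 ^ i))\<^sup>2 \<le> norm (real_quadratic w (y ^ (2 ^ i)))" for i w
  proof (induction i arbitrary: w)
    case 0
    obtain t1 t2 where t: "real_quadratic w y = real_quadratic t1 x * real_quadratic t2 x"
      using real_quadratic_compose[of w z x] unfolding y_def by blast
    have "m * m \<le> norm (real_quadratic t1 x) * norm (real_quadratic t2 x)"
      using m min by (intro mult_mono) auto
    then show ?case by (simp add: t norm_mult power2_eq_square)
  next
    case (Suc i)
    have "(m ^ (2 ^ i))\<^sup>2 * (m ^ (2 ^ i))\<^sup>2
        \<le> norm (real_quadratic (csqrt w) (y ^ (2 ^ i))) * norm (real_quadratic (- csqrt w) (y ^ (2 ^ i)))"
      using Suc.IH by (intro mult_mono) auto
    also have "\<dots> = norm (real_quadratic w ((y ^ (2 ^ i))\<^sup>2))"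
      by (metis norm_mult power2_csqrt real_quadratic_square)
    finally show ?case by (simp add: power_mult[symmetric] power_add[symmetric] mult.commute)
  qed
  have plus: "m ^ (2 ^ i) \<le> norm (y ^ (2 ^ i) + of_real c)" for i c
  proof -
    have "real_quadratic (of_real (- c)) (y ^ (2 ^ i)) = (y ^ (2 ^ i) + of_real c)\<^sup>2"
      by (simp add: real_quadratic_def)
    then have "(m ^ (2 ^ i))\<^sup>2 \<le> (norm (y ^ (2 ^ i) + of_real c))\<^sup>2"
      using low[of i "of_real (- c)"] by (simp add: norm_power)
    then show ?thesis using power2_le_imp_le norm_ge_zero by blast
  qed
  have le: "norm (y + of_real (m / 2)) \<le> m * (1 + (1 / 2) ^ (2 ^ j))" for j
  proof -
    define c :: 'k where "c = - of_real (m / 2)"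
    have cpow: "c ^ (2 ^ i) = of_real ((- (m / 2)) ^ (2 ^ i))" for i by (simp add: c_def)
    have plus': "m ^ (2 ^ i) \<le> norm (y ^ (2 ^ i) + c ^ (2 ^ i))" for i
      unfolding cpow by (rule plus)
    have pm: "(\<Prod>i<j. m ^ (2 ^ i)) * m = m ^ (2 ^ j)"
    proof (induction j)
      case (Suc j)
      have "(\<Prod>i<Suc j. m ^ (2 ^ i)) * m = ((\<Prod>i<j. m ^ (2 ^ i)) * m) * m ^ (2 ^ j)" by simp
      also have "\<dots> = m ^ (2 ^ Suc j)" unfolding Suc by (simp add: power_add[symmetric] mult_2)
      finally show ?case .
    qed simp
    have pp: "(\<Prod>i<j. m ^ (2 ^ i)) > 0" using m by (intro prod_pos) auto
    have "norm (y - c) * (\<Prod>i<j. m ^ (2 ^ i)) \<le> norm (y - c) * (\<Prod>i<j. norm (y ^ (2 ^ i) + c ^ (2 ^ i)))"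
      using m plus' by (intro mult_left_mono prod_mono) auto
    also have "\<dots> = norm (y ^ (2 ^ j) - c ^ (2 ^ j))"
      by (simp add: power_two_power_diff norm_mult prod_norm)
    also have "\<dots> \<le> m ^ (2 ^ j) + (m / 2) ^ (2 ^ j)"
      using norm_triangle_ineq4[of "y ^ (2 ^ j)" "c ^ (2 ^ j)"] m y by (simp add: norm_power c_def)
    also have "\<dots> = m ^ (2 ^ j) * (1 + (1 / 2) ^ (2 ^ j))"
      by (simp add: power_divide algebra_simps)
    also have "\<dots> = (m * (1 + (1 / 2) ^ (2 ^ j))) * (\<Prod>i<j. m ^ (2 ^ i))"
      by (subst pm[symmetric]) (simp only: mult_ac)
    finally show ?thesis using pp by (simp add: c_def)
  qed
  show ?thesis
  proof (rule ccontr)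
    assume "\<not> ?thesis"
    then have pos: "norm (real_quadratic z x + of_real (m / 2)) / m - 1 > 0" using m by simp
    have "\<exists>j. (1 / 2 :: real) ^ j < norm (real_quadratic z x + of_real (m / 2)) / m - 1"
      by (rule real_arch_pow_inv[OF pos]) simp
    then obtain j where j: "(1 / 2 :: real) ^ j < norm (real_quadratic z x + of_real (m / 2)) / m - 1"
      by blast
    have "(1 / 2 :: real) ^ (2 ^ j) \<le> (1 / 2) ^ j"
      by (rule power_decreasing) (simp_all add: less_imp_le)
    then have "1 + (1 / 2) ^ (2 ^ j) < norm (y + of_real (m / 2)) / m"
      using j unfolding y_def by linarith
    then have "m * (1 + (1 / 2) ^ (2 ^ j)) < m * (norm (y + of_real (m / 2)) / m)"
      using m by (rule mult_strict_left_mono)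
    then show False using le[of j] m by simp
  qed
qed

text \<open>
  The norm of the value at \<open>x\<close> of a real quadratic is coercive in its root \<open>z\<close>, so it has a minimum \<open>m\<close>.
  If \<open>m\<close> were positive, then with each minimal value \<open>y\<close> also \<open>y + m/2\<close> would be one; five such steps
  lead to a value of norm larger than \<open>m\<close>.
\<close>

lemma exists_real_quadratic_zero:
  fixes x :: "'k::real_normed_field"
  shows "\<exists>z. real_quadratic z x = 0"
proof (cases "x \<in> range of_real")
  case True
  then obtain r where "x = of_real r" by blast
  then have "real_quadratic (of_real r) x = 0"
    by (simp add: real_quadratic_def power2_eq_square algebra_simps)
  then show ?thesis by blast
next
  case False
  then obtain \<delta> where \<delta>: "\<delta> > 0" "\<And>a b. \<delta> * \<bar>a\<bar> \<le> norm (of_real a * x + of_real b)"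
      "\<And>a b. \<delta> * \<bar>b\<bar> \<le> norm (of_real a * x + of_real b)"
    using real_plane_norm_bound by metis
  have coercive: "\<delta> * (cmod z)\<^sup>2 \<le> norm (real_quadratic z x) + norm (x\<^sup>2)" for z
  proof -
    have "\<delta> * (cmod z)\<^sup>2 \<le> norm (of_real (- 2 * Re z) * x + of_real ((cmod z)\<^sup>2))"
      using \<delta>(3)[of "(cmod z)\<^sup>2" "- 2 * Re z"] by simp
    also have "\<dots> = norm (real_quadratic z x - x\<^sup>2)"
      by (simp add: real_quadratic_expand)
    also have "\<dots> \<le> norm (real_quadratic z x) + norm (x\<^sup>2)" by (rule norm_triangle_ineq4)
    finally show ?thesis .
  qed
  define R where "R = sqrt (2 * norm (x\<^sup>2) / \<delta>)"
  have R0: "R \<ge> 0" using \<delta> by (simp add: R_def)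
  have "continuous_on (cball 0 R) (\<lambda>z. norm (real_quadratic z x))"
    unfolding real_quadratic_def by (intro continuous_intros)
  then obtain z0 where z0: "\<And>z. z \<in> cball 0 R \<Longrightarrow> norm (real_quadratic z0 x) \<le> norm (real_quadratic z x)"
    using continuous_attains_inf[of "cball 0 R" "\<lambda>z. norm (real_quadratic z x)"] R0
    by (metis compact_cball cball_eq_empty linorder_not_less)
  define m where "m = norm (real_quadratic z0 x)"
  have min: "m \<le> norm (real_quadratic z x)" for z
  proof (cases "z \<in> cball 0 R")
    case False
    then have "R < cmod z" by simp
    then have "R\<^sup>2 < (cmod z)\<^sup>2" using R0 by (intro power_strict_mono) auto
    moreover have "R\<^sup>2 = 2 * norm (x\<^sup>2) / \<delta>" unfolding R_def
      using \<delta>(1) by (intro real_sqrt_pow2) simp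
    ultimately have "\<delta> * (cmod z)\<^sup>2 > 2 * norm (x\<^sup>2)"
      using \<delta>(1) by (simp add: field_simps)
    then have "norm (x\<^sup>2) \<le> norm (real_quadratic z x)"
      using coercive[of z] by linarith
    moreover have "m \<le> norm (real_quadratic 0 x)" using z0[of 0] R0 by (simp add: m_def)
    ultimately show ?thesis by (simp add: real_quadratic_def)
  qed (simp add: m_def z0)
  have "m = 0"
  proof (rule ccontr)
    assume "m \<noteq> 0"
    then have m: "m > 0" by (simp add: m_def)
    have "\<exists>z. real_quadratic z x = real_quadratic z0 x + of_real (of_nat n * (m / 2))
            \<and> norm (real_quadratic z x) = m" for n :: nat
    proof (induction n)
      case 0 then show ?case by (auto simp: m_def)
    next
      case (Suc n)
      then obtain z where z: "real_quadratic z x = real_quadratic z0 x + of_real (of_nat n * (m / 2))"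
        "norm (real_quadratic z x) = m" by blast
      define z' where "z' = Complex (Re z) (sqrt ((Im z)\<^sup>2 + m / 2))"
      \<comment> \<open>Raising the imaginary part of the root adds a positive constant to the quadratic. Subtracting one
        could make the discriminant positive, which is why the shift is by \<open>+ m / 2\<close>.\<close>
      have cm: "(cmod z')\<^sup>2 = (cmod z)\<^sup>2 + m / 2"
        using m by (simp add: cmod_power2 z'_def)
      have z': "real_quadratic z' x = real_quadratic z x + of_real (m / 2)"
        unfolding real_quadratic_expand cm by (simp add: z'_def)
      have "norm (real_quadratic z' x) = m"
        using quadratic_minimum_spreads[OF m min z(2)] min[of z'] z' by simp
      moreover have "real_quadratic z' x = real_quadratic z0 x + of_real (of_nat (Suc n) * (m / 2))"
        unfolding z' z by (simp add: algebra_simps add_divide_distrib)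
      ultimately show ?case by blast
    qed
    then obtain z where z: "real_quadratic z x = real_quadratic z0 x + of_real (of_nat 5 * (m / 2))"
      "norm (real_quadratic z x) = m" by blast
    have "norm (of_real (of_nat 5 * (m / 2)) :: 'k) = norm (real_quadratic z x - real_quadratic z0 x)"
      by (simp only: z(1) add_diff_cancel_left')
    also have "\<dots> \<le> m + m" using norm_triangle_ineq4[of "real_quadratic z x" "real_quadratic z0 x"] z(2)
      by (simp add: m_def)
    finally show False using m by (simp only: norm_of_real)
  qed
  then show ?thesis by (auto simp: m_def)
qed

lemma real_normed_field_Cauchy_convergent:
  fixes f :: "nat \<Rightarrow> 'k::real_normed_field"
  assumes "Cauchy f"
  shows "convergent f"
proof (cases "range of_real = (UNIV :: 'k set)")
  case True
  then show ?thesis using complete_of_real_image assms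
    by (metis UNIV_I completeE convergent_def)
next
  case False
  then obtain x :: 'k where x: "x \<notin> range of_real" by blast
  \<comment> \<open>Completing the square: every element differs from a real one by a root of a negative real.\<close>
  have square: "\<exists>r t. (y - of_real r)\<^sup>2 = - ((of_real t)\<^sup>2)" for y :: 'k
  proof -
    obtain z where z: "real_quadratic z y = 0" using exists_real_quadratic_zero by blast
    have "(y - of_real (Re z))\<^sup>2 = real_quadratic z y - (of_real (Im z))\<^sup>2"
      unfolding real_quadratic_def by simp
    then show ?thesis using z by auto
  qed
  obtain r t where rt: "(x - of_real r)\<^sup>2 = - ((of_real t)\<^sup>2)" using square by blast
  have "t \<noteq> 0"
  proof
    assume "t = 0"
    then have "x = of_real r" using rt by simp
    then show False using x by blast
  qed
  define j where "j = (x - of_real r) / of_real t"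
  have j2: "j\<^sup>2 = -1" using rt \<open>t \<noteq> 0\<close> by (simp add: j_def power_divide)
  have j: "j \<notin> range of_real"
  proof
    assume "j \<in> range of_real"
    then obtain u where "j = of_real u" by blast
    then have "x = of_real (t * u + r)" using \<open>t \<noteq> 0\<close> by (simp add: j_def field_simps)
    then show False using x by blast
  qed
  have decomp: "\<exists>u v. y = of_real u * j + of_real v" for y
  proof -
    obtain r' t' where "(y - of_real r')\<^sup>2 = - ((of_real t')\<^sup>2)" using square by blast
    then have "(y - of_real r')\<^sup>2 = (of_real t' * j)\<^sup>2" by (simp add: power_mult_distrib j2)
    then have "y - of_real r' = of_real t' * j \<or> y - of_real r' = - (of_real t' * j)"
      by (rule power2_eq_iff[THEN iffD1])
    then have "y = of_real t' * j + of_real r' \<or> y = of_real (- t') * j + of_real r'"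
      by (auto simp: algebra_simps)
    then show ?thesis by blast
  qed
  have "\<forall>n. \<exists>u v. f n = of_real u * j + of_real v" using decomp by blast
  then obtain u v where uv: "\<And>n. f n = of_real (u n) * j + of_real (v n)" by metis
  obtain \<delta> where \<delta>: "\<delta> > 0" "\<And>a b. \<delta> * \<bar>a\<bar> \<le> norm (of_real a * j + of_real b)"
      "\<And>a b. \<delta> * \<bar>b\<bar> \<le> norm (of_real a * j + of_real b)"
    using real_plane_norm_bound[OF j] by metis
  have fd: "f p - f l = of_real (u p - u l) * j + of_real (v p - v l)" for p l
    by (simp add: uv algebra_simps)
  have "Cauchy u" "Cauchy v"
  proof -
    have "\<exists>N. \<forall>p\<ge>N. \<forall>l\<ge>N. \<bar>u p - u l\<bar> < \<epsilon> \<and> \<bar>v p - v l\<bar> < \<epsilon>" if "\<epsilon> > 0" for \<epsilon>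
    proof -
      obtain N where N: "\<And>p l. p \<ge> N \<Longrightarrow> l \<ge> N \<Longrightarrow> norm (f p - f l) < \<delta> * \<epsilon>"
        using assms \<open>\<epsilon> > 0\<close> \<delta>(1) unfolding Cauchy_iff by (meson mult_pos_pos)
      have "\<bar>u p - u l\<bar> < \<epsilon> \<and> \<bar>v p - v l\<bar> < \<epsilon>" if "p \<ge> N" "l \<ge> N" for p l
        using N[OF that] \<delta>(2)[of "u p - u l" "v p - v l"] \<delta>(3)[of "v p - v l" "u p - u l"]
        unfolding fd[symmetric] using \<delta>(1) by (meson le_less_trans mult_less_cancel_left_pos)
      then show ?thesis by blast
    qed
    then show "Cauchy u" "Cauchy v" unfolding Cauchy_iff real_norm_def by blast+
  qed
  then obtain a b where "u \<longlonglongrightarrow> a" "v \<longlonglongrightarrow> b" by (metis Cauchy_convergent convergent_def)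
  then have "(\<lambda>n. of_real (u n) * j + of_real (v n)) \<longlonglongrightarrow> of_real a * j + of_real b"
    by (intro tendsto_intros)
  then show ?thesis unfolding convergent_def uv[abs_def] by blast
qed

section \<open>Series in normed spaces\<close>

text \<open>
  Interchange of the limits in \<open>N\<close> and \<open>j\<close> for the partial sums, by uniformity in \<open>N\<close>. This is how
  limits of expansions are recognised as expansions of limits.
\<close>

lemma sums_limit_interchange:
  fixes g :: "nat \<Rightarrow> nat \<Rightarrow> 'x::real_normed_vector"
  assumes sums: "\<And>j. g j sums G j" and G: "G \<longlonglongrightarrow> L"
    and terms: "\<And>n. (\<lambda>j. g j n) \<longlonglongrightarrow> h n"
    and unif: "\<And>\<epsilon>. \<epsilon> > 0 \<Longrightarrow> \<exists>J. \<forall>j\<ge>J. \<forall>l\<ge>J. \<forall>N. norm (\<Sum>n<N. g j n - g l n) \<le> \<epsilon>"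
  shows "h sums L"
  unfolding sums_def
proof (rule LIMSEQ_I)
  fix \<epsilon> :: real assume "\<epsilon> > 0"
  then have e3: "\<epsilon> / 3 > 0" by simp
  obtain J where J: "\<And>j l N. j \<ge> J \<Longrightarrow> l \<ge> J \<Longrightarrow> norm (\<Sum>n<N. g j n - g l n) \<le> \<epsilon> / 3"
    using unif[OF e3] by blast
  obtain J' where J': "\<And>j. j \<ge> J' \<Longrightarrow> norm (G j - L) < \<epsilon> / 3"
    using LIMSEQ_D[OF G e3] by blast
  define j where "j = max J J'"
  have lim: "norm (\<Sum>n<N. g j n - h n) \<le> \<epsilon> / 3" for N
  proof (rule LIMSEQ_le_const2)
    show "(\<lambda>l. norm (\<Sum>n<N. g j n - g l n)) \<longlonglongrightarrow> norm (\<Sum>n<N. g j n - h n)"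
      by (intro tendsto_intros terms)
    show "\<exists>M. \<forall>l\<ge>M. norm (\<Sum>n<N. g j n - g l n) \<le> \<epsilon> / 3"
      using J by (auto simp: j_def intro!: exI[of _ J])
  qed
  obtain N where N: "\<And>M. M \<ge> N \<Longrightarrow> norm ((\<Sum>n<M. g j n) - G j) < \<epsilon> / 3"
    using LIMSEQ_D[OF sums[of j, unfolded sums_def] e3] by blast
  have "norm ((\<Sum>n<M. h n) - L) < \<epsilon>" if "M \<ge> N" for M
  proof -
    have "(\<Sum>n<M. h n) - L = ((\<Sum>n<M. g j n) - G j) + (G j - L) - (\<Sum>n<M. g j n - h n)"
      by (simp add: sum_subtractf)
    also have "norm \<dots> \<le> norm ((\<Sum>n<M. g j n) - G j) + norm (G j - L) + norm (\<Sum>n<M. g j n - h n)"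
      using norm_triangle_ineq4[of "((\<Sum>n<M. g j n) - G j) + (G j - L)" "\<Sum>n<M. g j n - h n"]
        norm_triangle_ineq[of "(\<Sum>n<M. g j n) - G j" "G j - L"] by linarith
    also have "\<dots> < \<epsilon>" using N[OF that] J'[of j] lim[of M] by (simp add: j_def)
    finally show ?thesis .
  qed
  then show "\<exists>no. \<forall>n\<ge>no. norm ((\<Sum>n<n. h n) - L) < \<epsilon>" by blast
qed

text \<open>
  A convex function on a cube attains its maximum at a vertex.
\<close>

lemma norm_sum_le_vertices:
  fixes w :: "'i \<Rightarrow> 'x::real_normed_vector"
  assumes "finite H" and "\<And>n. n \<in> H \<Longrightarrow> 0 \<le> t n \<and> t n \<le> 1"
    and "\<And>H'. H' \<subseteq> H \<Longrightarrow> norm (z + (\<Sum>n\<in>H'. w n)) \<le> M"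
  shows "norm (z + (\<Sum>n\<in>H. t n *\<^sub>R w n)) \<le> M"
  using assms
proof (induction H arbitrary: z rule: finite_induct)
  case (insert n H)
  have a: "norm (z + (\<Sum>k\<in>H. t k *\<^sub>R w k)) \<le> M"
    using insert.prems by (intro insert.IH) blast+
  have b: "norm ((z + w n) + (\<Sum>k\<in>H. t k *\<^sub>R w k)) \<le> M"
  proof (intro insert.IH)
    fix H' assume "H' \<subseteq> H"
    moreover from this have "finite H'" "n \<notin> H'" using insert.hyps finite_subset by auto
    ultimately show "norm ((z + w n) + (\<Sum>k\<in>H'. w k)) \<le> M"
      using insert.prems(2)[of "insert n H'"] by (auto simp: add.assoc)
  qed (use insert.prems in blast)
  have t: "0 \<le> t n" "t n \<le> 1" using insert.prems(1) by auto
  have "z + (\<Sum>k\<in>insert n H. t k *\<^sub>R w k) = (1 - t n) *\<^sub>R (z + (\<Sum>k\<in>H. t k *\<^sub>R w k))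
      + t n *\<^sub>R ((z + w n) + (\<Sum>k\<in>H. t k *\<^sub>R w k))"
    using insert.hyps by (simp add: algebra_simps)
  also have "norm \<dots> \<le> norm ((1 - t n) *\<^sub>R (z + (\<Sum>k\<in>H. t k *\<^sub>R w k)))
      + norm (t n *\<^sub>R ((z + w n) + (\<Sum>k\<in>H. t k *\<^sub>R w k)))"
    by (rule norm_triangle_ineq)
  also have "\<dots> \<le> (1 - t n) * M + t n * M"
    using a b t by (intro add_mono) (simp_all add: mult_left_mono)
  also have "\<dots> = M" by (simp add: algebra_simps)
  finally show ?case .
qed auto

lemma norm_sum_multiplier_le:
  fixes w :: "'i \<Rightarrow> 'x::real_normed_vector"
  assumes H: "finite H" and t: "\<And>n. n \<in> H \<Longrightarrow> \<bar>t n\<bar> \<le> 1"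
    and M: "\<And>H'. H' \<subseteq> H \<Longrightarrow> norm (\<Sum>n\<in>H'. w n) \<le> M"
  shows "norm (\<Sum>n\<in>H. t n *\<^sub>R w n) \<le> 2 * M"
proof -
  have "norm (0 + (\<Sum>n\<in>H. max (t n) 0 *\<^sub>R w n)) \<le> M"
    using t M by (intro norm_sum_le_vertices[OF H]) (auto simp: abs_le_iff)
  moreover have "norm (0 + (\<Sum>n\<in>H. max (- t n) 0 *\<^sub>R w n)) \<le> M"
    using t M by (intro norm_sum_le_vertices[OF H]) (auto simp: abs_le_iff)
  moreover have "(\<Sum>n\<in>H. t n *\<^sub>R w n)
      = (\<Sum>n\<in>H. max (t n) 0 *\<^sub>R w n) - (\<Sum>n\<in>H. max (- t n) 0 *\<^sub>R w n)"
    unfolding sum_subtractf[symmetric] scaleR_left_diff_distrib[symmetric]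
    by (intro sum.cong) (auto simp: max_def)
  ultimately show ?thesis
    using norm_triangle_ineq4[of "\<Sum>n\<in>H. max (t n) 0 *\<^sub>R w n" "\<Sum>n\<in>H. max (- t n) 0 *\<^sub>R w n"]
    by simp
qed

lemma summable_on_finite_sums_bounded:
  fixes f :: "'i \<Rightarrow> 'x::real_normed_vector"
  assumes "f summable_on UNIV"
  shows "\<exists>M. \<forall>H. finite H \<longrightarrow> norm (sum f H) \<le> M"
proof -
  obtain l where "(sum f \<longlongrightarrow> l) (finite_subsets_at_top UNIV)"
    using assms unfolding summable_on_def has_sum_def by blast
  then have "\<forall>\<^sub>F H in finite_subsets_at_top UNIV. dist (sum f H) l < 1"
    by (rule tendstoD) simp
  then have "\<exists>F. finite F \<and> (\<forall>Y. finite Y \<and> F \<subseteq> Y \<longrightarrow> dist (sum f Y) l < 1)"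
    unfolding eventually_finite_subsets_at_top by simp
  then obtain F where F: "finite F" "\<And>Y. finite Y \<Longrightarrow> F \<subseteq> Y \<Longrightarrow> dist (sum f Y) l < 1"
    by auto
  have "norm (sum f H) \<le> (1 + norm l) + (\<Sum>i\<in>F. norm (f i))" if "finite H" for H
  proof -
    have "sum f (H \<union> F) = sum f H + sum f (F - H)"
      using that F(1) by (metis Diff_disjoint Un_Diff_cancel finite_Diff sum.union_disjoint)
    then have "norm (sum f H) \<le> norm (sum f (H \<union> F)) + norm (sum f (F - H))"
      by (metis add_diff_cancel_right' norm_triangle_ineq4)
    moreover have "norm (sum f (H \<union> F)) \<le> 1 + norm l"
      using F(2)[of "H \<union> F"] F(1) that norm_triangle_sub[of "sum f (H \<union> F)" l] by (simp add: dist_norm)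
    moreover have "norm (sum f (F - H)) \<le> (\<Sum>i\<in>F - H. norm (f i))" by (rule norm_sum)
    moreover have "\<dots> \<le> (\<Sum>i\<in>F. norm (f i))" using F(1) by (intro sum_mono2) auto
    ultimately show ?thesis by linarith
  qed
  then show ?thesis by blast
qed

text \<open>
  The inequalities available below hold up to a constant factor only.
\<close>

lemma tendsto_zero_dominated:
  fixes f g :: "nat \<Rightarrow> real"
  assumes "g \<longlonglongrightarrow> 0" and "\<And>i. \<bar>f i\<bar> \<le> c * g i"
  shows "f \<longlonglongrightarrow> 0"
proof (rule Lim_null_comparison)
  show "\<forall>\<^sub>F i in sequentially. norm (f i) \<le> c * g i" using assms(2) by simp
  show "(\<lambda>i. c * g i) \<longlonglongrightarrow> 0" by (rule tendsto_mult_right_zero[OF assms(1)])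
qed

section \<open>The unconditional constant of a basis\<close>

locale unconditional_basis_space =
  fixes sX :: "'k::real_normed_field \<Rightarrow> 'x::banach \<Rightarrow> 'x" and e :: "nat \<Rightarrow> 'x"
  assumes scaling: "normed_scaling sX" and basis: "unconditional_basis sX e"
begin

lemma norm_sX: "norm (sX c x) = norm c * norm x"
  using scaling unfolding normed_scaling_def by blast

lemma sX_of_real: "sX (of_real r) x = r *\<^sub>R x"
  using scaling unfolding normed_scaling_def by blast

sublocale vector_space sX
  using scaling unfolding normed_scaling_def by blast

definition coord :: "'x \<Rightarrow> nat \<Rightarrow> 'k" where
  "coord x = (THE c. (\<lambda>n. sX (c n) (e n)) sums x)"

lemma ex1_coord: "\<exists>!c. (\<lambda>n. sX (c n) (e n)) sums x"
  using basis by (simp add: unconditional_basis_def schauder_basis_def)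

lemma coord_sums: "(\<lambda>n. sX (coord x n) (e n)) sums x"
  unfolding coord_def by (rule theI'[OF ex1_coord])

lemma coord_eqI: "(\<lambda>n. sX (d n) (e n)) sums x \<Longrightarrow> coord x = d"
  using ex1_coord coord_sums by blast

lemma coord_add: "coord (x + y) n = coord x n + coord y n"
proof -
  have "(\<lambda>n. sX (coord x n + coord y n) (e n)) sums (x + y)"
    using sums_add[OF coord_sums coord_sums, of x y] by (simp add: scale_left_distrib)
  from coord_eqI[OF this] show ?thesis by simp
qed

lemma coord_scaleR: "coord (r *\<^sub>R x) n = of_real r * coord x n"
proof -
  have "(\<lambda>n. sX (of_real r * coord x n) (e n)) sums (r *\<^sub>R x)"
    using sums_scaleR_right[OF coord_sums, of r x]
    by (simp add: sX_of_real[symmetric] del: of_real_mult)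
  from coord_eqI[OF this] show ?thesis by simp
qed

lemma coord_zero: "coord 0 n = 0"
  using coord_scaleR[of 0 0 n] by simp

lemma basis_nonzero: "e m \<noteq> 0"
proof
  assume "e m = 0"
  then have "(\<lambda>n. sX (if n = m then 1 else 0) (e n)) sums 0"
    by (simp add: if_distrib[of "\<lambda>c. sX c _"] cong: if_cong)
  then have "coord 0 m = 1" by (simp add: coord_eqI)
  then show False using coord_zero by simp
qed

definition finite_part :: "nat set \<Rightarrow> 'x \<Rightarrow> 'x" where
  "finite_part H x = (\<Sum>n\<in>H. sX (coord x n) (e n))"

lemma finite_part_add: "finite_part H (x + y) = finite_part H x + finite_part H y"
  by (simp add: finite_part_def coord_add scale_left_distrib sum.distrib)

lemma finite_part_scaleR: "finite_part H (r *\<^sub>R x) = r *\<^sub>R finite_part H x"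
  by (simp add: finite_part_def coord_scaleR scale_scale[symmetric] sX_of_real scaleR_sum_right
      del: scale_scale)

lemma finite_part_zero: "finite_part H 0 = 0"
  using finite_part_scaleR[of H 0 0] by simp

lemma finite_part_diff: "finite_part H (x - y) = finite_part H x - finite_part H y"
  using finite_part_add[of H x "(-1) *\<^sub>R y"] finite_part_scaleR[of H "-1" y] by simp

lemma finite_part_sum: "finite_part H (\<Sum>j\<in>I. x j) = (\<Sum>j\<in>I. finite_part H (x j))"
  by (induction I rule: infinite_finite_induct) (simp_all add: finite_part_add finite_part_zero)

text \<open>
  The ball of radius \<open>r\<close> for the norm \<open>sup\<^sub>H \<parallel>finite_part H x\<parallel>\<close>. The unconditional constant exists because
  this norm is at most a multiple of the given one.
\<close>

definition level :: "real \<Rightarrow> 'x set" where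
  "level r = {x. \<forall>H. finite H \<longrightarrow> norm (finite_part H x) \<le> r}"

lemma level_diff: "x \<in> level r \<Longrightarrow> y \<in> level t \<Longrightarrow> x - y \<in> level (r + t)"
  unfolding level_def mem_Collect_eq finite_part_diff
  by (meson add_mono norm_triangle_ineq4 order_trans)

lemma level_scaleR:
  assumes "x \<in> level r"
  shows "c *\<^sub>R x \<in> level (\<bar>c\<bar> * r)"
  unfolding level_def
proof (intro CollectI allI impI)
  fix H :: "nat set" assume "finite H"
  then have "norm (finite_part H x) \<le> r" using assms unfolding level_def by simp
  then show "norm (finite_part H (c *\<^sub>R x)) \<le> \<bar>c\<bar> * r"
    by (simp add: finite_part_scaleR mult_left_mono)
qed

lemma level_mono: "r \<le> t \<Longrightarrow> level r \<subseteq> level t"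
  unfolding level_def by force

lemma ex_level: "\<exists>m::nat. x \<in> level (real m)"
proof -
  have "(\<lambda>n. sX (coord x n) (e n)) summable_on UNIV"
    using basis coord_sums[of x] unfolding unconditional_basis_def summable_def by blast
  then obtain c where "\<And>H. finite H \<Longrightarrow> norm (finite_part H x) \<le> c"
    unfolding finite_part_def using summable_on_finite_sums_bounded by blast
  then have "x \<in> level (real (nat \<lceil>c\<rceil>))" unfolding level_def by (auto intro: order_trans[OF _ real_nat_ceiling_ge])
  then show ?thesis by blast
qed

text \<open>
  Baire's theorem gives one level whose closure contains a ball; differences and dilations of
  levels move the ball to the origin and give every vector a bound proportional to its norm.
\<close>

lemma levels_approximate:
  "\<exists>K>0. \<forall>h. \<forall>\<delta>>0. \<exists>y\<in>level (K * norm h). norm (h - y) < \<delta>"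
proof -
  have "\<exists>m::nat. interior (closure (level (real m))) \<noteq> {}"
  proof (rule ccontr)
    assume "\<not> ?thesis"
    then have "euclidean interior_of \<Union> (range (\<lambda>m::nat. closure (level (real m)))) = {}"
      by (intro Met_TC.metric_Baire_category_alt[unfolded mtopology_is_euclidean])
        (auto simp: complete_UNIV closed_closedin[symmetric])
    moreover have "\<Union> (range (\<lambda>m::nat. closure (level (real m)))) = UNIV"
    proof (intro set_eqI iffI UNIV_I)
      fix x
      obtain m :: nat where "x \<in> level (real m)" using ex_level[of x] ..
      then show "x \<in> \<Union> (range (\<lambda>m::nat. closure (level (real m))))"
        using closure_subset[of "level (real m)"] by (intro UN_I[of m]) auto
    qed
    ultimately show False by simp
  qed
  then obtain m :: nat and x0 r where r: "r > 0" "ball x0 r \<subseteq> closure (level (real m))"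
    by (meson all_not_in_conv mem_interior)
  have small: "\<exists>y\<in>level (2 * real m). norm (h - y) < \<delta>" if h: "norm h < r" and "\<delta> > 0" for h \<delta>
  proof -
    have "x0 + h \<in> closure (level (real m))" "x0 \<in> closure (level (real m))"
      using r h by (auto simp: dist_norm)
    then obtain y1 y0 where y: "y1 \<in> level (real m)" "dist y1 (x0 + h) < \<delta> / 2"
      "y0 \<in> level (real m)" "dist y0 x0 < \<delta> / 2"
      using \<open>\<delta> > 0\<close> unfolding closure_approachable by (meson half_gt_zero)
    have "norm (h - (y1 - y0)) = norm ((y0 - x0) - (y1 - (x0 + h)))" by (simp add: algebra_simps)
    also have "\<dots> \<le> norm (y0 - x0) + norm (y1 - (x0 + h))" by (rule norm_triangle_ineq4)
    also have "\<dots> < \<delta>" using y by (simp add: dist_norm)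
    finally show ?thesis using level_diff[OF y(1,3)] by auto
  qed
  define K where "K = 4 * (real m + 1) / r"
  have K: "K > 0" using r by (simp add: K_def)
  have "\<exists>y\<in>level (K * norm h). norm (h - y) < \<delta>" if "\<delta> > 0" for h \<delta>
  proof (cases "h = 0")
    case True
    then show ?thesis using \<open>\<delta> > 0\<close> by (intro bexI[of _ 0]) (auto simp: level_def finite_part_zero)
  next
    case False
    define s where "s = r / (2 * norm h)"
    have s: "s > 0" using False r by (simp add: s_def)
    have "norm (s *\<^sub>R h) < r" using False r by (simp add: s_def)
    then obtain y where y: "y \<in> level (2 * real m)" "norm (s *\<^sub>R h - y) < s * \<delta>"
      using small[of "s *\<^sub>R h" "s * \<delta>"] s \<open>\<delta> > 0\<close> by auto
    have "norm (h - (1 / s) *\<^sub>R y) = (1 / s) * norm (s *\<^sub>R h - y)"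
    proof -
      have "h - (1 / s) *\<^sub>R y = (1 / s) *\<^sub>R (s *\<^sub>R h - y)" using s by (simp add: algebra_simps)
      then show ?thesis using s by simp
    qed
    also have "\<dots> < (1 / s) * (s * \<delta>)" using y(2) s by (intro mult_strict_left_mono) auto
    also have "\<dots> = \<delta>" using s by simp
    finally have 1: "norm (h - (1 / s) *\<^sub>R y) < \<delta>" .
    have "\<bar>1 / s\<bar> * (2 * real m) \<le> K * norm h"
      using s False r by (simp add: s_def K_def divide_right_mono)
    then have "(1 / s) *\<^sub>R y \<in> level (K * norm h)"
      using level_scaleR[OF y(1), of "1 / s"] level_mono by blast
    then show ?thesis using 1 by blast
  qed
  then show ?thesis using K by blast
qed

text \<open>
  The closure in the previous lemma is removed as in the open mapping theorem: \<open>x\<close> is the sum of \<open>y\<^sub>j\<close>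
  in the levels \<open>K \<parallel>x\<parallel> / 2\<^sup>j\<close>. The coordinates of the partial sums are Cauchy sequences of scalars, and
  their limits must be the coordinates of \<open>x\<close>, since the partial expansions converge uniformly.
\<close>

lemma finite_parts_bounded:
  "\<exists>K>0. \<forall>x H. finite H \<longrightarrow> norm (finite_part H x) \<le> K * norm x"
proof -
  obtain K where K: "K > 0" "\<And>h \<delta>. \<delta> > 0 \<Longrightarrow> \<exists>y\<in>level (K * norm h). norm (h - y) < \<delta>"
    using levels_approximate by blast
  have "norm (finite_part H x) \<le> 2 * K * norm x" if H: "finite H" for x H
  proof (cases "x = 0")
    case False
    \<comment> \<open>Successive approximation: \<open>ap r\<close> has controlled finite parts and removes half of \<open>r\<close>.\<close>
    have "\<exists>y. y \<in> level (K * norm r) \<and> norm (r - y) \<le> norm r / 2" for r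
    proof (cases "r = 0")
      case True
      then show ?thesis by (intro exI[of _ 0]) (simp add: level_def finite_part_zero)
    next
      case False
      then show ?thesis using K(2)[of "norm r / 2" r] by (auto intro: less_imp_le)
    qed
    then have "\<forall>r. \<exists>y. y \<in> level (K * norm r) \<and> norm (r - y) \<le> norm r / 2" ..
    from choice[OF this] obtain ap where
      ap: "\<And>r. ap r \<in> level (K * norm r)" "\<And>r. norm (r - ap r) \<le> norm r / 2" by auto
    define r where "r j = ((\<lambda>r. r - ap r) ^^ j) x" for j :: nat
    define y where "y j = ap (r j)" for j
    have r0: "r 0 = x" and rS: "r (Suc j) = r j - y j" for j by (simp_all add: r_def y_def)
    have r_le: "norm (r j) \<le> norm x * (1 / 2) ^ j" for j
    proof (induction j)
      case (Suc j)
      have "norm (r (Suc j)) \<le> norm (r j) / 2" using ap(2)[of "r j"] by (simp add: rS y_def)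
      then show ?case using Suc by simp
    qed (simp add: r0)
    have partial: "(\<Sum>j<J. y j) = x - r J" for J
      by (induction J) (simp_all add: r0 rS)
    define M where "M = K * norm x"
    have M0: "M \<ge> 0" using K(1) by (simp add: M_def)
    have y_part: "norm (finite_part H (y j)) \<le> M * (1 / 2) ^ j" if "finite H" for H j
    proof -
      have "norm (finite_part H (y j)) \<le> K * norm (r j)"
        using ap(1)[of "r j"] that by (simp add: level_def y_def)
      also have "\<dots> \<le> K * (norm x * (1 / 2) ^ j)" using r_le K(1) by (intro mult_left_mono) auto
      finally show ?thesis by (simp add: M_def mult.assoc)
    qed
    define Y where "Y J = (\<Sum>j<J. y j)" for J :: nat
    have rlim: "r \<longlonglongrightarrow> 0"
    proof (rule Lim_null_comparison)
      show "\<forall>\<^sub>F j in sequentially. norm (r j) \<le> norm x * (1 / 2) ^ j" using r_le by simp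
      have "(\<lambda>j. (1 / 2 :: real) ^ j) \<longlonglongrightarrow> 0" by (rule LIMSEQ_realpow_zero) auto
      then show "(\<lambda>j. norm x * (1 / 2) ^ j) \<longlonglongrightarrow> 0" by (rule tendsto_mult_right_zero)
    qed
    have Ylim: "Y \<longlonglongrightarrow> x"
      using tendsto_diff[OF tendsto_const[of x] rlim] unfolding Y_def partial by simp
    have geometric: "(\<Sum>j=I..<J. (1 / 2 :: real) ^ j) \<le> 2 * (1 / 2) ^ I" for I J
    proof -
      have "(\<Sum>j=I..<J. (1 / 2 :: real) ^ j) \<le> 2 * (1 / 2) ^ I - 2 * (1 / 2) ^ J" if "I \<le> J"
        using that by (induction J rule: dec_induct) simp_all
      moreover have "(1 / 2 :: real) ^ J \<ge> 0" by simp
      ultimately show ?thesis by (cases "I \<le> J") (linarith, simp)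
    qed
    have part_Y: "norm (finite_part H (Y J - Y I)) \<le> M * (2 * (1 / 2) ^ I)" if "I \<le> J" "finite H" for H I J
    proof -
      have "Y J - Y I = (\<Sum>j=I..<J. y j)"
        unfolding Y_def using that(1) by (simp add: sum_diff_nat_ivl lessThan_atLeast0)
      then have "norm (finite_part H (Y J - Y I)) \<le> (\<Sum>j=I..<J. norm (finite_part H (y j)))"
        by (simp add: finite_part_sum norm_sum)
      also have "\<dots> \<le> (\<Sum>j=I..<J. M * (1 / 2) ^ j)" by (intro sum_mono y_part that)
      also have "\<dots> \<le> M * (2 * (1 / 2) ^ I)"
        unfolding sum_distrib_left[symmetric] using geometric M0 by (intro mult_left_mono)
      finally show ?thesis .
    qed
    have unif: "\<exists>J. \<forall>j\<ge>J. \<forall>l\<ge>J. \<forall>H. finite H \<longrightarrow> norm (finite_part H (Y j - Y l)) \<le> \<epsilon>" if "\<epsilon> > 0" for \<epsilon>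
    proof -
      have "(\<lambda>I. M * (2 * (1 / 2) ^ I)) \<longlonglongrightarrow> M * (2 * 0)"
        by (intro tendsto_mult tendsto_const LIMSEQ_realpow_zero) auto
      then have "\<forall>\<^sub>F I in sequentially. M * (2 * (1 / 2) ^ I) < \<epsilon>"
        using \<open>\<epsilon> > 0\<close> by (intro order_tendstoD(2)) auto
      then obtain J where J: "\<And>I. I \<ge> J \<Longrightarrow> M * (2 * (1 / 2) ^ I) < \<epsilon>"
        unfolding eventually_sequentially by auto
      have ordered: "norm (finite_part H (Y j - Y l)) \<le> \<epsilon>" if "l \<ge> J" "l \<le> j" "finite H" for j l H
        using part_Y[OF that(2,3)] J[OF that(1)] by simp
      have "norm (finite_part H (Y j - Y l)) \<le> \<epsilon>" if "j \<ge> J" "l \<ge> J" "finite H" for j l H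
      proof (cases "l \<le> j")
        case False
        then have "norm (finite_part H (Y l - Y j)) \<le> \<epsilon>" using that by (intro ordered) auto
        then show ?thesis by (simp add: finite_part_diff norm_minus_commute)
      qed (use ordered that in auto)
      then show ?thesis by auto
    qed
    have "\<exists>d. (\<lambda>J. coord (Y J) n) \<longlonglongrightarrow> d" for n
    proof -
      have "Cauchy (\<lambda>J. coord (Y J) n)"
        unfolding Cauchy_iff
      proof (intro allI impI)
        fix \<epsilon> :: real assume "\<epsilon> > 0"
        then obtain J where J: "\<And>j l H. j \<ge> J \<Longrightarrow> l \<ge> J \<Longrightarrow> finite H \<Longrightarrow>
            norm (finite_part H (Y j - Y l)) \<le> \<epsilon> / 2 * norm (e n)"
          using unif[of "\<epsilon> / 2 * norm (e n)"] basis_nonzero[of n] by auto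
        have "norm (coord (Y j) n - coord (Y l) n) < \<epsilon>" if "j \<ge> J" "l \<ge> J" for j l
        proof -
          have "norm (coord (Y j) n - coord (Y l) n) * norm (e n) \<le> \<epsilon> / 2 * norm (e n)"
            using J[OF that, of "{n}"]
            by (simp add: finite_part_diff) (simp add: finite_part_def scale_left_diff_distrib[symmetric] norm_sX)
          then have "norm (coord (Y j) n - coord (Y l) n) \<le> \<epsilon> / 2"
            using basis_nonzero[of n] by (simp add: mult_le_cancel_right)
          then show ?thesis using \<open>\<epsilon> > 0\<close> by simp
        qed
        then show "\<exists>M. \<forall>m\<ge>M. \<forall>l\<ge>M. norm (coord (Y m) n - coord (Y l) n) < \<epsilon>" by auto
      qed
      then show ?thesis using real_normed_field_Cauchy_convergent unfolding convergent_def by blast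
    qed
    then have "\<forall>n. \<exists>d. (\<lambda>J. coord (Y J) n) \<longlonglongrightarrow> d" ..
    from choice[OF this] obtain d where d: "\<And>n. (\<lambda>J. coord (Y J) n) \<longlonglongrightarrow> d n" by auto
    have terms: "(\<lambda>J. sX (coord (Y J) n) (e n)) \<longlonglongrightarrow> sX (d n) (e n)" for n
    proof (rule LIM_zero_cancel, rule tendsto_norm_zero_cancel)
      have "(\<lambda>J. norm (coord (Y J) n - d n) * norm (e n)) \<longlonglongrightarrow> 0"
        using tendsto_norm_zero[OF LIM_zero[OF d[of n]]] by (rule tendsto_mult_left_zero)
      then show "(\<lambda>J. norm (sX (coord (Y J) n) (e n) - sX (d n) (e n))) \<longlonglongrightarrow> 0"
        by (simp add: scale_left_diff_distrib[symmetric] norm_sX)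
    qed
    have "(\<lambda>n. sX (d n) (e n)) sums x"
    proof (rule sums_limit_interchange[OF coord_sums Ylim terms])
      fix \<epsilon> :: real assume "\<epsilon> > 0"
      then obtain J where J: "\<And>j l H. j \<ge> J \<Longrightarrow> l \<ge> J \<Longrightarrow> finite H \<Longrightarrow>
          norm (finite_part H (Y j - Y l)) \<le> \<epsilon>"
        using unif[of \<epsilon>] by auto
      have "norm (\<Sum>n<N. sX (coord (Y j) n) (e n) - sX (coord (Y l) n) (e n)) \<le> \<epsilon>"
        if "j \<ge> J" "l \<ge> J" for j l N
        using J[OF that, of "{..<N}"] by (simp add: finite_part_diff) (simp add: finite_part_def sum_subtractf)
      then show "\<exists>J. \<forall>j\<ge>J. \<forall>l\<ge>J. \<forall>N.
          norm (\<Sum>n<N. sX (coord (Y j) n) (e n) - sX (coord (Y l) n) (e n)) \<le> \<epsilon>" by auto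
    qed
    then have cx: "coord x = d" by (rule coord_eqI)
    have "(\<lambda>J. norm (finite_part H (Y J))) \<longlonglongrightarrow> norm (finite_part H x)"
      unfolding finite_part_def cx by (intro tendsto_norm tendsto_sum terms)
    moreover have "norm (finite_part H (Y J)) \<le> 2 * K * norm x" for J
      using part_Y[of 0 J H] H by (simp add: Y_def M_def)
    ultimately show ?thesis by (intro LIMSEQ_le_const2) auto
  qed (simp add: finite_part_zero)
  then show ?thesis using K(1) by (intro exI[of _ "2 * K"]) auto
qed

text \<open>
  A coefficient sequence \<open>u\<close> dominated by \<open>v\<close> has the form \<open>t v\<close> with \<open>\<bar>t\<^sub>n\<bar> \<le> 1\<close>, so the bound for finite
  parts extends from subsets, that is \<open>0\<close>-\<open>1\<close> multipliers, to all multipliers in \<open>[-1, 1]\<close>. Applied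
  to the tails of \<open>v\<close> it also gives convergence.
\<close>

lemma solid_norm_constant:
  "\<exists>C\<ge>1. \<forall>u v. (\<forall>n. \<bar>u n\<bar> \<le> \<bar>v n\<bar>) \<longrightarrow> summable (\<lambda>n. v n *\<^sub>R e n) \<longrightarrow>
     summable (\<lambda>n. u n *\<^sub>R e n) \<and> norm (\<Sum>n. u n *\<^sub>R e n) \<le> C * norm (\<Sum>n. v n *\<^sub>R e n)"
proof -
  obtain K where K: "K > 0" "\<And>x H. finite H \<Longrightarrow> norm (finite_part H x) \<le> K * norm x"
    using finite_parts_bounded by blast
  have fin: "norm (\<Sum>n\<in>H. u n *\<^sub>R e n) \<le> 2 * K * norm (\<Sum>n. v n *\<^sub>R e n)"
    if uv: "\<And>n. \<bar>u n\<bar> \<le> \<bar>v n\<bar>" and v: "summable (\<lambda>n. v n *\<^sub>R e n)" and H: "finite H" for u v :: "nat \<Rightarrow> real" and H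
  proof -
    define x where "x = (\<Sum>n. v n *\<^sub>R e n)"
    have "(\<lambda>n. sX (of_real (v n)) (e n)) sums x"
      unfolding sX_of_real x_def using v by (rule summable_sums)
    then have "coord x = (\<lambda>n. of_real (v n))" by (rule coord_eqI)
    then have part: "finite_part H' x = (\<Sum>n\<in>H'. v n *\<^sub>R e n)" for H'
      by (simp add: finite_part_def sX_of_real)
    define t where "t n = (if v n = 0 then 0 else u n / v n)" for n
    have tv: "u n = t n * v n" for n using uv[of n] by (auto simp: t_def)
    have "\<bar>t n\<bar> \<le> 1" for n using uv[of n] by (auto simp: t_def field_simps)
    moreover have "norm (\<Sum>n\<in>H'. v n *\<^sub>R e n) \<le> K * norm x" if "H' \<subseteq> H" for H'
      unfolding part[symmetric] by (intro K(2) finite_subset[OF that H])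
    ultimately have "norm (\<Sum>n\<in>H. t n *\<^sub>R v n *\<^sub>R e n) \<le> 2 * (K * norm x)"
      by (intro norm_sum_multiplier_le H) auto
    then show ?thesis by (simp add: tv x_def)
  qed
  have "summable (\<lambda>n. u n *\<^sub>R e n) \<and> norm (\<Sum>n. u n *\<^sub>R e n) \<le> (2 * K + 1) * norm (\<Sum>n. v n *\<^sub>R e n)"
    if uv: "\<And>n. \<bar>u n\<bar> \<le> \<bar>v n\<bar>" and v: "summable (\<lambda>n. v n *\<^sub>R e n)" for u v :: "nat \<Rightarrow> real"
  proof
    show sum: "summable (\<lambda>n. u n *\<^sub>R e n)"
      unfolding summable_Cauchy
    proof (intro allI impI)
      fix \<epsilon> :: real assume "\<epsilon> > 0"
      then have "\<epsilon> / (2 * K) > 0" using K(1) by simp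
      from LIMSEQ_D[OF summable_LIMSEQ[OF v] this] obtain N where
        N: "\<And>m. m \<ge> N \<Longrightarrow> norm ((\<Sum>n<m. v n *\<^sub>R e n) - (\<Sum>n. v n *\<^sub>R e n)) < \<epsilon> / (2 * K)" by auto
      have "norm (\<Sum>i=m..<l. u i *\<^sub>R e i) < \<epsilon>" if "m \<ge> N" for m l
      proof -
        \<comment> \<open>The tails of \<open>v\<close> are compared with those of \<open>u\<close>; their sums tend to zero.\<close>
        define v' where "v' n = (if n < m then 0 else v n)" for n
        define u' where "u' n = (if n < m then 0 else u n)" for n
        have "(\<lambda>n. v n *\<^sub>R e n - (if n \<in> {..<m} then v n *\<^sub>R e n else 0))
            sums ((\<Sum>n. v n *\<^sub>R e n) - (\<Sum>n\<in>{..<m}. v n *\<^sub>R e n))"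
          by (intro sums_diff summable_sums[OF v] sums_If_finite_set) simp
        moreover have "(\<lambda>n. v n *\<^sub>R e n - (if n \<in> {..<m} then v n *\<^sub>R e n else 0)) = (\<lambda>n. v' n *\<^sub>R e n)"
          by (auto simp: v'_def)
        ultimately have v': "(\<lambda>n. v' n *\<^sub>R e n) sums ((\<Sum>n. v n *\<^sub>R e n) - (\<Sum>n<m. v n *\<^sub>R e n))"
          by simp
        have "norm (\<Sum>i=m..<l. u' i *\<^sub>R e i) \<le> 2 * K * norm (\<Sum>n. v' n *\<^sub>R e n)"
          using uv v' by (intro fin) (auto simp: u'_def v'_def sums_iff)
        also have "\<dots> < 2 * K * (\<epsilon> / (2 * K))"
          using N[OF that] K(1) sums_unique[OF v'] by (intro mult_strict_left_mono) (auto simp: norm_minus_commute)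
        also have "\<dots> = \<epsilon>" using K(1) by simp
        finally have "norm (\<Sum>i=m..<l. u' i *\<^sub>R e i) < \<epsilon>" .
        moreover have "(\<Sum>i=m..<l. u' i *\<^sub>R e i) = (\<Sum>i=m..<l. u i *\<^sub>R e i)"
          by (intro sum.cong) (auto simp: u'_def)
        ultimately show ?thesis by simp
      qed
      then show "\<exists>N. \<forall>m\<ge>N. \<forall>n. norm (\<Sum>i=m..<n. u i *\<^sub>R e i) < \<epsilon>" by auto
    qed
    have "norm (\<Sum>n. u n *\<^sub>R e n) \<le> 2 * K * norm (\<Sum>n. v n *\<^sub>R e n)"
      using tendsto_norm[OF summable_LIMSEQ[OF sum]] fin[OF uv v] by (intro LIMSEQ_le_const2) auto
    then show "norm (\<Sum>n. u n *\<^sub>R e n) \<le> (2 * K + 1) * norm (\<Sum>n. v n *\<^sub>R e n)"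
      by (simp add: algebra_simps add_increasing)
  qed
  then show ?thesis using K(1) by (intro exI[of _ "2 * K + 1"]) auto
qed

end

section \<open>Weighted vector valued sequence spaces\<close>

text \<open>
  Of the basis only its solidity with constant \<open>C\<close> is kept, and that for real coefficients: the series
  that define the norms have non-negative ones.
\<close>

locale weighted_sequence_spaces =
  fixes e :: "nat \<Rightarrow> 'x::banach" and C :: real
    and s :: "'k::real_normed_field \<Rightarrow> 'b::ab_group_add \<Rightarrow> 'b"
    and E :: "nat \<Rightarrow> 'b set" and q :: "nat \<Rightarrow> 'b \<Rightarrow> real"
  assumes C_ge_1: "1 \<le> C" and e_nonzero: "\<And>n. e n \<noteq> 0"
    and solid: "\<And>u v. (\<And>n. \<bar>u n\<bar> \<le> \<bar>v n\<bar>) \<Longrightarrow> summable (\<lambda>n. v n *\<^sub>R e n) \<Longrightarrow>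
      summable (\<lambda>n. u n *\<^sub>R e n) \<and> norm (\<Sum>n. u n *\<^sub>R e n) \<le> C * norm (\<Sum>n. v n *\<^sub>R e n)"
    and vector_space_s: "vector_space s"
    and banach_E: "\<And>n. banach_space_on s (E n) (q n)"
begin

sublocale vector_space s by (rule vector_space_s)

lemma normed_E: "normed_space_on s (E n) (q n)"
  using banach_E[of n] unfolding banach_space_on_def by simp

lemma E_subspace: "subspace (E n)"
  using normed_E[of n] unfolding normed_space_on_def by simp

lemmas E_zero = subspace_0[OF E_subspace]
  and E_add = subspace_add[OF E_subspace]
  and E_diff = subspace_diff[OF E_subspace]
  and E_scale = subspace_scale[OF E_subspace]

lemma q_nonneg: "x \<in> E n \<Longrightarrow> 0 \<le> q n x"
  and q_eq_0_iff: "x \<in> E n \<Longrightarrow> q n x = 0 \<longleftrightarrow> x = 0"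
  and q_triangle: "x \<in> E n \<Longrightarrow> y \<in> E n \<Longrightarrow> q n (x + y) \<le> q n x + q n y"
  and q_scale: "x \<in> E n \<Longrightarrow> q n (s c x) = norm c * q n x"
  using normed_E[of n] unfolding normed_space_on_def by simp_all

lemma q_zero: "q n 0 = 0"
  using q_eq_0_iff[OF E_zero, of n] by simp

lemma q_minus_commute: "x \<in> E n \<Longrightarrow> y \<in> E n \<Longrightarrow> q n (x - y) = q n (y - x)"
  using q_scale[OF E_diff, of x n y "-1"] by simp

lemma q_diff_le: "x \<in> E n \<Longrightarrow> y \<in> E n \<Longrightarrow> \<bar>q n x - q n y\<bar> \<le> q n (x - y)"
  using q_triangle[OF E_diff, of x n y y] q_triangle[OF E_diff, of y n x x] q_minus_commute[of x n y]
  by (simp add: abs_le_iff)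

definition weighted_space :: "(nat \<Rightarrow> real) \<Rightarrow> (nat \<Rightarrow> 'b) set" where
  "weighted_space w = {x. (\<forall>n. x n \<in> E n) \<and> summable (weighted_series e q w x)}"

abbreviation p :: "(nat \<Rightarrow> real) \<Rightarrow> (nat \<Rightarrow> 'b) \<Rightarrow> real" where
  "p \<equiv> weighted_norm e q"

lemma weighted_spaceD: "x \<in> weighted_space w \<Longrightarrow> x n \<in> E n"
  and weighted_space_summable: "x \<in> weighted_space w \<Longrightarrow> summable (\<lambda>n. (w n * q n (x n)) *\<^sub>R e n)"
  unfolding weighted_space_def weighted_series_def by simp_all

lemma weighted_spaceI:
  "(\<And>n. x n \<in> E n) \<Longrightarrow> summable (\<lambda>n. (w n * q n (x n)) *\<^sub>R e n) \<Longrightarrow> x \<in> weighted_space w"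
  unfolding weighted_space_def weighted_series_def by simp

lemma p_eq: "p w x = norm (\<Sum>n. (w n * q n (x n)) *\<^sub>R e n)"
  unfolding weighted_norm_def weighted_series_def ..

lemma p_nonneg: "0 \<le> p w x"
  by (simp add: p_eq)

lemma dominated:
  assumes "\<And>n. x n \<in> E n" and "\<And>n. \<bar>w n * q n (x n)\<bar> \<le> \<bar>v n\<bar>" and "summable (\<lambda>n. v n *\<^sub>R e n)"
  shows "x \<in> weighted_space w" and "p w x \<le> C * norm (\<Sum>n. v n *\<^sub>R e n)"
  using solid[of "\<lambda>n. w n * q n (x n)" v] assms by (auto simp: p_eq intro: weighted_spaceI)

lemma finite_support_sums:
  assumes "\<And>n. n \<notin> H \<Longrightarrow> v n = 0" and "finite H"
  shows "(\<lambda>n. v n *\<^sub>R e n) sums (\<Sum>n\<in>H. v n *\<^sub>R e n)"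
  using assms by (intro sums_finite) auto

lemma partial_sum_norm_le:
  assumes "summable (\<lambda>n. v n *\<^sub>R e n)" and "finite H"
  shows "norm (\<Sum>n\<in>H. v n *\<^sub>R e n) \<le> C * norm (\<Sum>n. v n *\<^sub>R e n)"
proof -
  define u where "u n = (if n \<in> H then v n else 0)" for n
  have "(\<lambda>n. u n *\<^sub>R e n) sums (\<Sum>n\<in>H. u n *\<^sub>R e n)"
    using assms(2) by (intro finite_support_sums) (simp_all add: u_def)
  then have "(\<Sum>n. u n *\<^sub>R e n) = (\<Sum>n\<in>H. v n *\<^sub>R e n)"
    by (simp add: sums_iff u_def)
  moreover have "norm (\<Sum>n. u n *\<^sub>R e n) \<le> C * norm (\<Sum>n. v n *\<^sub>R e n)"
    using solid[of u v] assms(1) by (simp add: u_def)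
  ultimately show ?thesis by simp
qed

text \<open>
  By solidity the \<open>N\<close>-th partial sums of a convergent sequence of expansions are Cauchy uniformly in \<open>N\<close>,
  so the coefficientwise limit is the expansion of the limit.
\<close>

lemma coefficient_limit_sums:
  assumes sum: "\<And>j. summable (\<lambda>n. u j n *\<^sub>R e n)"
    and lim: "(\<lambda>j. \<Sum>n. u j n *\<^sub>R e n) \<longlonglongrightarrow> L"
    and coef: "\<And>n. (\<lambda>j. u j n) \<longlonglongrightarrow> v n"
  shows "(\<lambda>n. v n *\<^sub>R e n) sums L"
proof (rule sums_limit_interchange[OF summable_sums[OF sum] lim])
  show "(\<lambda>j. u j n *\<^sub>R e n) \<longlonglongrightarrow> v n *\<^sub>R e n" for n by (intro tendsto_intros coef)
  fix \<epsilon> :: real assume "\<epsilon> > 0"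
  then have "\<epsilon> / C > 0" using C_ge_1 by simp
  from lim[THEN LIMSEQ_imp_Cauchy, THEN CauchyD, OF this] obtain J where
    J: "\<And>j l. j \<ge> J \<Longrightarrow> l \<ge> J \<Longrightarrow> norm ((\<Sum>n. u j n *\<^sub>R e n) - (\<Sum>n. u l n *\<^sub>R e n)) < \<epsilon> / C" by auto
  have "norm (\<Sum>n<N. u j n *\<^sub>R e n - u l n *\<^sub>R e n) \<le> \<epsilon>" if "j \<ge> J" "l \<ge> J" for j l N
  proof -
    have "summable (\<lambda>n. (u j n - u l n) *\<^sub>R e n)"
      using summable_diff[OF sum sum, of j l] by (simp add: scaleR_left_diff_distrib)
    then have "norm (\<Sum>n<N. (u j n - u l n) *\<^sub>R e n) \<le> C * norm (\<Sum>n. (u j n - u l n) *\<^sub>R e n)"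
      by (rule partial_sum_norm_le) simp
    also have "(\<Sum>n. (u j n - u l n) *\<^sub>R e n) = (\<Sum>n. u j n *\<^sub>R e n) - (\<Sum>n. u l n *\<^sub>R e n)"
      using suminf_diff[OF sum sum, of j l] by (simp add: scaleR_left_diff_distrib)
    also have "C * norm \<dots> \<le> C * (\<epsilon> / C)" using J[OF that] C_ge_1 by (intro mult_left_mono) auto
    finally show ?thesis using C_ge_1 by (simp add: scaleR_left_diff_distrib)
  qed
  then show "\<exists>J. \<forall>j\<ge>J. \<forall>l\<ge>J. \<forall>N. norm (\<Sum>n<N. u j n *\<^sub>R e n - u l n *\<^sub>R e n) \<le> \<epsilon>" by auto
qed

context
  fixes w :: "nat \<Rightarrow> real"
  assumes w: "\<And>n. 0 < w n"
begin

lemma weighted_space_add: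
  assumes x: "x \<in> weighted_space w" and y: "y \<in> weighted_space w"
  shows "x + y \<in> weighted_space w" and "p w (x + y) \<le> C * (p w x + p w y)"
proof -
  have E: "x n \<in> E n" "y n \<in> E n" for n using x y weighted_spaceD by auto
  define v where "v n = w n * q n (x n) + w n * q n (y n)" for n
  have v: "(\<lambda>n. v n *\<^sub>R e n)
      sums ((\<Sum>n. (w n * q n (x n)) *\<^sub>R e n) + (\<Sum>n. (w n * q n (y n)) *\<^sub>R e n))"
    using sums_add[OF summable_sums summable_sums, OF weighted_space_summable weighted_space_summable, OF x y]
    by (simp add: v_def scaleR_left_distrib)
  have dom: "\<bar>w n * q n ((x + y) n)\<bar> \<le> \<bar>v n\<bar>" for n
  proof -
    have "0 \<le> q n (x n + y n)" by (rule q_nonneg[OF E_add[OF E]])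
    moreover have "w n * q n (x n + y n) \<le> w n * (q n (x n) + q n (y n))"
      using w[of n] q_triangle[OF E] by simp
    ultimately show ?thesis using w[of n] by (simp add: v_def distrib_left)
  qed
  have E': "(x + y) n \<in> E n" for n using E E_add by simp
  show "x + y \<in> weighted_space w" by (rule dominated(1)[OF E' dom sums_summable[OF v]])
  have "p w (x + y) \<le> C * norm ((\<Sum>n. (w n * q n (x n)) *\<^sub>R e n) + (\<Sum>n. (w n * q n (y n)) *\<^sub>R e n))"
    using dominated(2)[of "x + y" w v, OF E' dom sums_summable[OF v]] unfolding sums_unique[OF v, symmetric] .
  also have "\<dots> \<le> C * (p w x + p w y)"
    unfolding p_eq using C_ge_1 by (intro mult_left_mono norm_triangle_ineq) simp
  finally show "p w (x + y) \<le> C * (p w x + p w y)" .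
qed

lemma weighted_space_scale:
  assumes x: "x \<in> weighted_space w"
  shows "seq_scale s c x \<in> weighted_space w" and "p w (seq_scale s c x) = norm c * p w x"
proof -
  have E: "x n \<in> E n" for n using x weighted_spaceD by auto
  have "(\<lambda>n. (w n * q n (seq_scale s c x n)) *\<^sub>R e n) = (\<lambda>n. norm c *\<^sub>R (w n * q n (x n)) *\<^sub>R e n)"
    by (simp add: seq_scale_def q_scale[OF E] mult_ac)
  then have "(\<lambda>n. (w n * q n (seq_scale s c x n)) *\<^sub>R e n) sums (norm c *\<^sub>R (\<Sum>n. (w n * q n (x n)) *\<^sub>R e n))"
    using sums_scaleR_right[OF summable_sums[OF weighted_space_summable[OF x]], of "norm c"] by simp
  note * = this
  show "seq_scale s c x \<in> weighted_space w"
    using E E_scale by (intro weighted_spaceI sums_summable[OF *]) (simp add: seq_scale_def)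
  show "p w (seq_scale s c x) = norm c * p w x"
    unfolding p_eq sums_unique[OF *, symmetric] by simp
qed

lemma zero_in_weighted_space: "0 \<in> weighted_space w"
  by (intro weighted_spaceI) (simp_all add: E_zero q_zero)

lemma p_zero: "p w 0 = 0"
  by (simp add: p_eq q_zero)

lemma weighted_space_diff:
  assumes x: "x \<in> weighted_space w" and y: "y \<in> weighted_space w"
  shows "x - y \<in> weighted_space w"
proof -
  have "x - y = x + seq_scale s (-1) y" by (auto simp: seq_scale_def)
  also have "\<dots> \<in> weighted_space w" by (rule weighted_space_add(1)[OF x weighted_space_scale(1)[OF y]])
  finally show ?thesis .
qed

lemma p_minus_commute:
  assumes "x \<in> weighted_space w" and "y \<in> weighted_space w"
  shows "p w (x - y) = p w (y - x)"
proof -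
  have "q n (x n - y n) = q n (y n - x n)" for n
    using assms weighted_spaceD by (intro q_minus_commute) auto
  then show ?thesis by (simp add: p_eq)
qed

lemma p_triangle:
  assumes x: "x \<in> weighted_space w" and y: "y \<in> weighted_space w" and z: "z \<in> weighted_space w"
  shows "p w (x - z) \<le> C * (p w (x - y) + p w (y - z))"
proof -
  have "x - z = (x - y) + (y - z)" by auto
  then show ?thesis using weighted_space_add(2)[OF weighted_space_diff[OF x y] weighted_space_diff[OF y z]] by simp
qed

text \<open>
  The inequality \<open>\<bar>q(x) - q(y)\<bar> \<le> q(x - y)\<close>, summed up by means of solidity. It replaces the triangle
  inequality, which \<open>p\<close> satisfies up to the factor \<open>C\<close> only.
\<close>

lemma series_diff_le:
  assumes x: "x \<in> weighted_space w" and y: "y \<in> weighted_space w"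
  shows "norm ((\<Sum>n. (w n * q n (x n)) *\<^sub>R e n) - (\<Sum>n. (w n * q n (y n)) *\<^sub>R e n)) \<le> C * p w (x - y)"
proof -
  define u where "u n = w n * q n (x n) - w n * q n (y n)" for n
  have "\<bar>u n\<bar> \<le> \<bar>w n * q n ((x - y) n)\<bar>" for n
  proof -
    have E: "x n \<in> E n" "y n \<in> E n" using x y weighted_spaceD by auto
    have "\<bar>u n\<bar> = w n * \<bar>q n (x n) - q n (y n)\<bar>"
      using w[of n] by (simp add: u_def abs_mult right_diff_distrib[symmetric])
    also have "\<dots> \<le> w n * q n (x n - y n)" using q_diff_le[OF E] w[of n] by simp
    finally show ?thesis by simp
  qed
  then have "norm (\<Sum>n. u n *\<^sub>R e n) \<le> C * p w (x - y)"
    unfolding p_eq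
    by (intro conjunct2[OF solid] weighted_space_summable[OF weighted_space_diff[OF x y]])
  moreover have "(\<Sum>n. u n *\<^sub>R e n) = (\<Sum>n. (w n * q n (x n)) *\<^sub>R e n) - (\<Sum>n. (w n * q n (y n)) *\<^sub>R e n)"
    using suminf_diff[OF weighted_space_summable weighted_space_summable, OF x y]
    by (simp add: u_def scaleR_left_diff_distrib)
  ultimately show ?thesis by simp
qed

lemma p_Lipschitz:
  assumes "x \<in> weighted_space w" and "y \<in> weighted_space w"
  shows "\<bar>p w x - p w y\<bar> \<le> C * p w (x - y)"
  using series_diff_le[OF assms] norm_triangle_ineq3 unfolding p_eq by (rule order_trans[rotated])

lemma coordinate_le:
  assumes x: "x \<in> weighted_space w"
  shows "w n * q n (x n) * norm (e n) \<le> C * p w x"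
  using partial_sum_norm_le[OF weighted_space_summable[OF x], of "{n}"]
    q_nonneg[OF weighted_spaceD[OF x], of n] w[of n]
  by (simp add: p_eq abs_mult)

lemma coordinate_le':
  assumes x: "x \<in> weighted_space w"
  shows "q n (x n) \<le> C / (w n * norm (e n)) * p w x"
  using coordinate_le[OF x, of n] w[of n] e_nonzero[of n] by (simp add: field_simps)

lemma p_eq_0_iff:
  assumes x: "x \<in> weighted_space w"
  shows "p w x = 0 \<longleftrightarrow> x = 0"
proof
  assume "p w x = 0"
  then have "q n (x n) \<le> 0" for n using coordinate_le'[OF x, of n] by simp
  then have "x n = 0" for n
    using q_nonneg[OF weighted_spaceD[OF x]] q_eq_0_iff[OF weighted_spaceD[OF x]] by (metis order_antisym)
  then show "x = 0" by auto
qed (simp add: p_zero)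

text \<open>
  Each coordinate converges in its Banach space. To see that the limit \<open>x\<close> lies in the space, the
  vectors of \<open>X\<close> that represent \<open>f i - f j\<close> are a Cauchy sequence in \<open>j\<close>, and their limit has the
  coefficients of \<open>f i - x\<close>.
\<close>

lemma weighted_space_complete:
  assumes f: "\<And>i. f i \<in> weighted_space w"
    and Cauchy: "\<And>\<epsilon>. \<epsilon> > 0 \<Longrightarrow> \<exists>N. \<forall>i\<ge>N. \<forall>j\<ge>N. p w (f i - f j) < \<epsilon>"
  shows "\<exists>x\<in>weighted_space w. (\<lambda>i. p w (f i - x)) \<longlonglongrightarrow> 0"
proof -
  have fE: "f i n \<in> E n" for i n using f weighted_spaceD by auto
  have fd: "f i - f j \<in> weighted_space w" for i j by (intro weighted_space_diff f)
  have "\<exists>l. l \<in> E n \<and> (\<lambda>i. q n (f i n - l)) \<longlonglongrightarrow> 0" for n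
  proof -
    have "\<exists>N. \<forall>i\<ge>N. \<forall>j\<ge>N. q n (f i n - f j n) < \<epsilon>" if "\<epsilon> > 0" for \<epsilon>
    proof -
      define c where "c = C / (w n * norm (e n))"
      have c: "c > 0" using C_ge_1 w[of n] e_nonzero[of n] by (simp add: c_def)
      obtain N where N: "\<forall>i\<ge>N. \<forall>j\<ge>N. p w (f i - f j) < \<epsilon> / c"
        using Cauchy[of "\<epsilon> / c"] c \<open>\<epsilon> > 0\<close> by auto
      have "q n (f i n - f j n) < \<epsilon>" if "i \<ge> N" "j \<ge> N" for i j
      proof -
        have "q n (f i n - f j n) \<le> c * p w (f i - f j)"
          using coordinate_le'[OF fd, of n i j] by (simp add: c_def)
        also have "\<dots> < c * (\<epsilon> / c)" using N that c by (intro mult_strict_left_mono) auto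
        finally show ?thesis using c by simp
      qed
      then show ?thesis by auto
    qed
    moreover have "\<forall>i. f i n \<in> E n" using fE by blast
    ultimately have "\<exists>l\<in>E n. (\<lambda>i. q n (f i n - l)) \<longlonglongrightarrow> 0"
      using banach_E[of n, unfolded banach_space_on_def, THEN conjunct2, THEN spec, of "\<lambda>i. f i n"] by simp
    then show ?thesis by blast
  qed
  then have "\<forall>n. \<exists>l. l \<in> E n \<and> (\<lambda>i. q n (f i n - l)) \<longlonglongrightarrow> 0" ..
  from choice[OF this] obtain x where xE: "\<And>n. x n \<in> E n"
    and xlim: "\<And>n. (\<lambda>i. q n (f i n - x n)) \<longlonglongrightarrow> 0" by auto
  have coef: "(\<lambda>j. w n * q n ((f i - f j) n)) \<longlonglongrightarrow> w n * q n ((f i - x) n)" for i n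
  proof (intro tendsto_mult tendsto_const, rule LIM_zero_cancel, rule Lim_null_comparison)
    show "\<forall>\<^sub>F j in sequentially. norm (q n ((f i - f j) n) - q n ((f i - x) n)) \<le> q n (f j n - x n)"
    proof (intro always_eventually allI)
      fix j
      have "\<bar>q n (f i n - f j n) - q n (f i n - x n)\<bar> \<le> q n ((f i n - f j n) - (f i n - x n))"
        by (intro q_diff_le E_diff fE xE)
      also have "(f i n - f j n) - (f i n - x n) = x n - f j n" by simp
      also have "q n (x n - f j n) = q n (f j n - x n)" by (intro q_minus_commute fE xE)
      finally show "norm (q n ((f i - f j) n) - q n ((f i - x) n)) \<le> q n (f j n - x n)" by simp
    qed
  qed (rule xlim)
  have fx: "\<exists>L. (\<lambda>j. \<Sum>n. (w n * q n ((f i - f j) n)) *\<^sub>R e n) \<longlonglongrightarrow> L" for i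
  proof -
    have "Cauchy (\<lambda>j. \<Sum>n. (w n * q n ((f i - f j) n)) *\<^sub>R e n)"
      unfolding Cauchy_iff
    proof (intro allI impI)
      fix \<epsilon> :: real assume "\<epsilon> > 0"
      then obtain N where N: "\<forall>i\<ge>N. \<forall>j\<ge>N. p w (f i - f j) < \<epsilon> / C"
        using Cauchy[of "\<epsilon> / C"] C_ge_1 by auto
      have "norm ((\<Sum>n. (w n * q n ((f i - f j) n)) *\<^sub>R e n) - (\<Sum>n. (w n * q n ((f i - f l) n)) *\<^sub>R e n)) < \<epsilon>"
        if "j \<ge> N" "l \<ge> N" for j l
      proof -
        have "(f i - f j) - (f i - f l) = f l - f j" by auto
        then have "norm ((\<Sum>n. (w n * q n ((f i - f j) n)) *\<^sub>R e n) - (\<Sum>n. (w n * q n ((f i - f l) n)) *\<^sub>R e n))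
            \<le> C * p w (f l - f j)"
          using series_diff_le[OF fd fd, of i j i l] by simp
        also have "\<dots> < C * (\<epsilon> / C)" using N that C_ge_1 by (intro mult_strict_left_mono) auto
        finally show ?thesis using C_ge_1 by simp
      qed
      then show "\<exists>M. \<forall>m\<ge>M. \<forall>l\<ge>M. norm ((\<Sum>n. (w n * q n ((f i - f m) n)) *\<^sub>R e n)
          - (\<Sum>n. (w n * q n ((f i - f l) n)) *\<^sub>R e n)) < \<epsilon>" by auto
    qed
    then show ?thesis using Cauchy_convergent unfolding convergent_def by blast
  qed
  have diff: "f i - x \<in> weighted_space w \<and> (\<lambda>j. p w (f i - f j)) \<longlonglongrightarrow> p w (f i - x)" for i
  proof -
    obtain L where L: "(\<lambda>j. \<Sum>n. (w n * q n ((f i - f j) n)) *\<^sub>R e n) \<longlonglongrightarrow> L" using fx by blast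
    have sums: "(\<lambda>n. (w n * q n ((f i - x) n)) *\<^sub>R e n) sums L"
      by (rule coefficient_limit_sums[OF weighted_space_summable[OF fd] L coef])
    have "f i - x \<in> weighted_space w"
      using fE xE E_diff by (intro weighted_spaceI sums_summable[OF sums]) simp
    moreover have "(\<lambda>j. p w (f i - f j)) \<longlonglongrightarrow> p w (f i - x)"
      using tendsto_norm[OF L] unfolding p_eq sums_unique[OF sums, symmetric] .
    ultimately show ?thesis ..
  qed
  have "x = f 0 - (f 0 - x)" by auto
  then have "x \<in> weighted_space w" using weighted_space_diff[OF f[of 0] conjunct1[OF diff[of 0]]] by simp
  moreover have "(\<lambda>i. p w (f i - x)) \<longlonglongrightarrow> 0"
  proof (rule LIMSEQ_I)
    fix \<epsilon> :: real assume "\<epsilon> > 0"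
    then obtain N where N: "\<forall>i\<ge>N. \<forall>j\<ge>N. p w (f i - f j) < \<epsilon> / 2"
      using Cauchy[of "\<epsilon> / 2"] by auto
    have "p w (f i - x) \<le> \<epsilon> / 2" if "i \<ge> N" for i
      using N that by (intro LIMSEQ_le_const2[OF conjunct2[OF diff[of i]]]) (auto intro: less_imp_le)
    then have "norm (p w (f i - x) - 0) < \<epsilon>" if "i \<ge> N" for i
      using that p_nonneg[of w "f i - x"] \<open>\<epsilon> > 0\<close> by (smt (verit) field_sum_of_halves real_norm_def)
    then show "\<exists>no. \<forall>i\<ge>no. norm (p w (f i - x) - 0) < \<epsilon>" by auto
  qed
  ultimately show ?thesis by blast
qed

end

definition truncation :: "nat \<Rightarrow> (nat \<Rightarrow> 'b) \<Rightarrow> nat \<Rightarrow> 'b" where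
  "truncation N x n = (if n < N then x n else 0)"

lemma truncation_in_weighted_space:
  assumes "\<And>n. x n \<in> E n"
  shows "truncation N x \<in> weighted_space w"
proof (intro weighted_spaceI)
  show "truncation N x n \<in> E n" for n using assms E_zero by (simp add: truncation_def)
  show "summable (\<lambda>n. (w n * q n (truncation N x n)) *\<^sub>R e n)"
    by (intro sums_summable[OF finite_support_sums[of "{..<N}"]]) (simp_all add: truncation_def q_zero)
qed

text \<open>
  The norm of the difference is that of a tail of one convergent series.
\<close>

lemma truncation_converges:
  assumes x: "x \<in> weighted_space w"
  shows "(\<lambda>N. p w (truncation N x - x)) \<longlonglongrightarrow> 0"
proof -
  define S where "S = (\<Sum>n. (w n * q n (x n)) *\<^sub>R e n)"
  have "p w (truncation N x - x) = norm (S - (\<Sum>n<N. (w n * q n (x n)) *\<^sub>R e n))" for N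
  proof -
    have "(\<lambda>n. (w n * q n (x n)) *\<^sub>R e n - (if n \<in> {..<N} then (w n * q n (x n)) *\<^sub>R e n else 0))
        sums (S - (\<Sum>n\<in>{..<N}. (w n * q n (x n)) *\<^sub>R e n))"
      unfolding S_def by (intro sums_diff summable_sums[OF weighted_space_summable[OF x]] sums_If_finite_set) simp
    moreover have "(w n * q n (x n)) *\<^sub>R e n - (if n \<in> {..<N} then (w n * q n (x n)) *\<^sub>R e n else 0)
        = (w n * q n ((truncation N x - x) n)) *\<^sub>R e n" for n
      using q_minus_commute[OF E_zero weighted_spaceD[OF x], of n] by (simp add: truncation_def q_zero)
    ultimately have "(\<lambda>n. (w n * q n ((truncation N x - x) n)) *\<^sub>R e n)
        sums (S - (\<Sum>n<N. (w n * q n (x n)) *\<^sub>R e n))" by simp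
    from sums_unique[OF this] show ?thesis by (simp add: p_eq)
  qed
  moreover have "(\<lambda>N. norm (S - (\<Sum>n<N. (w n * q n (x n)) *\<^sub>R e n))) \<longlonglongrightarrow> norm (S - S)"
    unfolding S_def by (intro tendsto_intros summable_LIMSEQ weighted_space_summable x)
  ultimately show ?thesis by simp
qed

lemma vector_space_seq_scale: "vector_space (seq_scale s)"
  by unfold_locales (simp_all add: seq_scale_def fun_eq_iff scale_right_distrib scale_left_distrib)

sublocale seqs: vector_space "seq_scale s" by (rule vector_space_seq_scale)

lemma weighted_space_subspace:
  "(\<And>n. 0 < w n) \<Longrightarrow> seqs.subspace (weighted_space w)"
  unfolding seqs.subspace_def
  using weighted_space_add(1) weighted_space_scale(1) zero_in_weighted_space by blast

definition single :: "nat \<Rightarrow> 'b \<Rightarrow> nat \<Rightarrow> 'b" where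
  "single n z = (\<lambda>m. if m = n then z else 0)"

lemma single_in_weighted_space:
  assumes "z \<in> E n"
  shows "single n z \<in> weighted_space w" and "p w (single n z) = \<bar>w n\<bar> * q n z * norm (e n)"
proof -
  have *: "(\<lambda>m. (w m * q m (single n z m)) *\<^sub>R e m) sums (\<Sum>m\<in>{n}. (w m * q m (single n z m)) *\<^sub>R e m)"
    by (intro finite_support_sums) (simp_all add: single_def q_zero)
  show "single n z \<in> weighted_space w"
    using assms E_zero by (intro weighted_spaceI sums_summable[OF *]) (simp add: single_def)
  show "p w (single n z) = \<bar>w n\<bar> * q n z * norm (e n)"
    unfolding p_eq sums_unique[OF *, symmetric] using q_nonneg[OF assms] by (simp add: single_def abs_mult)
qed

end

section \<open>Bounded subsets of the Koethe space\<close>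

locale koethe_sequence_space = weighted_sequence_spaces e C s E q
  for e :: "nat \<Rightarrow> 'x::banach" and C :: real
    and s :: "'k::real_normed_field \<Rightarrow> 'b::ab_group_add \<Rightarrow> 'b"
    and E :: "nat \<Rightarrow> 'b set" and q :: "nat \<Rightarrow> 'b \<Rightarrow> real" +
  fixes a :: "nat \<Rightarrow> nat \<Rightarrow> real"
  assumes a_pos: "\<And>k n. 0 < a k n"
begin

abbreviation \<K> :: "(nat \<Rightarrow> 'b) set" where
  "\<K> \<equiv> koethe_space e a E q"

lemma koethe_space_iff: "x \<in> \<K> \<longleftrightarrow> (\<forall>k. x \<in> weighted_space (a k))"
  unfolding koethe_space_def weighted_space_def by simp

lemma koethe_space_subset: "x \<in> \<K> \<Longrightarrow> x \<in> weighted_space (a k)"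
  by (simp add: koethe_space_iff)

lemma koethe_space_subspace: "seqs.subspace \<K>"
proof -
  have "\<K> = \<Inter> (range (\<lambda>k. weighted_space (a k)))" by (auto simp: koethe_space_iff)
  then show ?thesis using weighted_space_subspace[OF a_pos] by (auto intro!: seqs.subspace_Inter)
qed

lemmas koethe_space_zero = seqs.subspace_0[OF koethe_space_subspace]
  and koethe_space_add = seqs.subspace_add[OF koethe_space_subspace]
  and koethe_space_diff = seqs.subspace_diff[OF koethe_space_subspace]
  and koethe_space_scale = seqs.subspace_scale[OF koethe_space_subspace]

lemma topspace_koethe: "topspace (koethe_topology e a E q) = \<K>"
proof -
  have "openin (koethe_topology e a E q) \<K>"
    unfolding openin_koethe_topology using zero_less_one by blast
  moreover have "topspace (koethe_topology e a E q) \<subseteq> \<K>"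
    using openin_topspace[of "koethe_topology e a E q"] unfolding openin_koethe_topology by blast
  ultimately show ?thesis using openin_subset by blast
qed

text \<open>
  Openness rests on the Lipschitz estimate for \<open>p\<close>; the radius is divided by its constant.
\<close>

lemma openin_seminorm_ball: "openin (koethe_topology e a E q) {x \<in> \<K>. p (a k) x < 1}"
  unfolding openin_koethe_topology
proof (intro conjI ballI)
  fix x assume x: "x \<in> {x \<in> \<K>. p (a k) x < 1}"
  define \<epsilon> where "\<epsilon> = (1 - p (a k) x) / C"
  have "y \<in> {x \<in> \<K>. p (a k) x < 1}" if y: "y \<in> \<K>" "\<forall>l\<le>k. p (a l) (y - x) < \<epsilon>" for y
  proof -
    have "p (a k) y - p (a k) x \<le> C * p (a k) (y - x)"
      using p_Lipschitz[OF a_pos koethe_space_subset koethe_space_subset, of y x k] y(1) x by auto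
    also have "\<dots> < C * \<epsilon>" using y(2) C_ge_1 by (intro mult_strict_left_mono) auto
    also have "\<dots> = 1 - p (a k) x" using C_ge_1 by (simp add: \<epsilon>_def)
    finally show ?thesis using y(1) by simp
  qed
  moreover have "\<epsilon> > 0" using x C_ge_1 by (simp add: \<epsilon>_def)
  ultimately show "\<exists>\<epsilon>>0. \<exists>m. \<forall>y\<in>\<K>. (\<forall>l\<le>m. p (a l) (y - x) < \<epsilon>) \<longrightarrow> y \<in> {x \<in> \<K>. p (a k) x < 1}"
    by blast
qed auto

lemma bounded_iff:
  "bounded_wrt (seq_scale s) (koethe_topology e a E q) B \<longleftrightarrow>
     B \<subseteq> \<K> \<and> (\<forall>k. \<exists>M. \<forall>x\<in>B. p (a k) x \<le> M)" (is "?bdd \<longleftrightarrow> ?sub \<and> ?norms")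
proof
  assume bdd: ?bdd
  have "\<exists>M. \<forall>x\<in>B. p (a k) x \<le> M" for k
  proof -
    have "0 \<in> {x \<in> \<K>. p (a k) x < 1}" using koethe_space_zero by (simp add: p_zero[OF a_pos])
    then obtain r where r: "r > 0" "\<forall>t>r. B \<subseteq> seq_scale s (of_real t) ` {x \<in> \<K>. p (a k) x < 1}"
      using bdd openin_seminorm_ball[of k] unfolding bounded_wrt_def by blast
    have "p (a k) x \<le> r + 1" if "x \<in> B" for x
    proof -
      have "x \<in> seq_scale s (of_real (r + 1)) ` {x \<in> \<K>. p (a k) x < 1}"
        using r(2)[rule_format, of "r + 1"] that by auto
      then obtain y where y: "y \<in> \<K>" "p (a k) y < 1" "x = seq_scale s (of_real (r + 1)) y" by auto
      have "p (a k) x = \<bar>r + 1\<bar> * p (a k) y"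
        unfolding y(3) weighted_space_scale(2)[OF a_pos koethe_space_subset[OF y(1)]] by (simp only: norm_of_real)
      also have "\<dots> \<le> (r + 1) * 1" using y(2) r(1) p_nonneg by (intro mult_mono) auto
      finally show ?thesis by simp
    qed
    then show ?thesis by blast
  qed
  moreover have ?sub using bdd unfolding bounded_wrt_def topspace_koethe by blast
  ultimately show "?sub \<and> ?norms" by blast
next
  assume *: "?sub \<and> ?norms"
  then have "\<forall>k. \<exists>M. \<forall>x\<in>B. p (a k) x \<le> M" by blast
  from choice[OF this] obtain M where M: "\<And>k x. x \<in> B \<Longrightarrow> p (a k) x \<le> M k" by auto
  show ?bdd unfolding bounded_wrt_def topspace_koethe
  proof (intro conjI allI impI)
    fix U assume U: "openin (koethe_topology e a E q) U \<and> 0 \<in> U"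
    then have "\<exists>\<epsilon>>0. \<exists>m. \<forall>y\<in>\<K>. (\<forall>k\<le>m. p (a k) (y - 0) < \<epsilon>) \<longrightarrow> y \<in> U"
      unfolding openin_koethe_topology by blast
    then obtain \<epsilon> m where \<epsilon>: "\<epsilon> > 0" "\<And>y. y \<in> \<K> \<Longrightarrow> (\<And>k. k \<le> m \<Longrightarrow> p (a k) y < \<epsilon>) \<Longrightarrow> y \<in> U"
      by auto
    define r where "r = (\<Sum>k\<le>m. \<bar>M k\<bar>) / \<epsilon> + 1"
    have r: "r > 0" using \<epsilon>(1) by (simp add: r_def add_nonneg_pos sum_nonneg)
    have "x \<in> seq_scale s (of_real t) ` U" if t: "t > r" and x: "x \<in> B" for t x
    proof
      have t0: "t > 0" using t r by simp
      have xK: "x \<in> \<K>" using * x by blast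
      show "x = seq_scale s (of_real t) (seq_scale s (of_real (1 / t)) x)"
        using t0 by (simp add: of_real_mult[symmetric] del: of_real_divide)
      show "seq_scale s (of_real (1 / t)) x \<in> U"
      proof (rule \<epsilon>(2))
        fix k assume k: "k \<le> m"
        have "p (a k) x \<le> \<bar>M k\<bar>" using M[OF x, of k] by simp
        also have "\<dots> \<le> (\<Sum>k\<le>m. \<bar>M k\<bar>)" using k by (intro member_le_sum) auto
        also have "\<dots> < t * \<epsilon>" using t \<epsilon>(1) by (simp add: r_def field_simps)
        finally have "p (a k) x / t < \<epsilon>" using t0 by (simp add: field_simps)
        then show "p (a k) (seq_scale s (of_real (1 / t)) x) < \<epsilon>"
          unfolding weighted_space_scale(2)[OF a_pos koethe_space_subset[OF xK]] norm_of_real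
          using t0 by simp
      qed (rule koethe_space_scale[OF xK])
    qed
    then show "\<exists>r>0. \<forall>t>r. B \<subseteq> seq_scale s (of_real t) ` U" using r by blast
  qed (use * in blast)
qed

lemma koethe_ball_iff:
  "x \<in> koethe_ball e a E q b \<longleftrightarrow> x \<in> \<K> \<and> x \<in> weighted_space b \<and> p b x \<le> 1"
  unfolding koethe_ball_def koethe_space_def weighted_space_def by auto

text \<open>
  The weight is \<open>b n = (\<Sum>k. c k * a k n)\<close>. The sequence \<open>c\<close> must decrease so fast that this converges
  and that the bounds \<open>M k\<close> of the given set contribute at most \<open>1\<close> in total.
\<close>

lemma bounded_subset_koethe_ball:
  assumes B: "bounded_wrt (seq_scale s) (koethe_topology e a E q) B"
  shows "\<exists>b. (\<forall>n. 0 < b n) \<and> bounded_wrt (seq_scale s) (koethe_topology e a E q) (koethe_ball e a E q b)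
    \<and> B \<subseteq> koethe_ball e a E q b"
proof -
  have BK: "B \<subseteq> \<K>" and "\<forall>k. \<exists>M. \<forall>x\<in>B. p (a k) x \<le> M" using B unfolding bounded_iff by auto
  from choice[OF this(2)] obtain M where M: "\<And>k x. x \<in> B \<Longrightarrow> p (a k) x \<le> M k" by auto
  \<comment> \<open>The sum over \<open>n \<le> k\<close> makes \<open>c k * a k n \<le> 1 / 2 ^ Suc k\<close> for all \<open>k \<ge> n\<close>, hence for almost all \<open>k\<close>.\<close>
  define D where "D k = \<bar>M k\<bar> + 1 + (\<Sum>n\<le>k. a k n)" for k
  have a_sum: "0 \<le> (\<Sum>n\<le>k. a k n)" for k using a_pos by (intro sum_nonneg) (auto intro: less_imp_le)
  have D: "D k > 0" for k using a_sum[of k] by (simp add: D_def)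
  define c where "c k = (1 / 2) ^ Suc k / D k" for k
  have c: "c k > 0" for k using D by (simp add: c_def)
  have half: "(\<lambda>k. (1 / 2 :: real) ^ Suc k) sums 1" by (rule power_half_series)
  have c_le: "c k * t \<le> (1 / 2) ^ Suc k" if "t \<le> D k" for k t
  proof -
    have "c k * t \<le> c k * D k" using c[of k] that by (intro mult_left_mono) auto
    then show ?thesis using D[of k] by (simp add: c_def)
  qed
  have summ: "summable (\<lambda>k. c k * a k n)" for n
  proof (rule summable_comparison_test_ev[OF _ sums_summable[OF half]])
    have "norm (c k * a k n) \<le> (1 / 2) ^ Suc k" if "k \<ge> n" for k
    proof -
      have "a k n \<le> (\<Sum>n\<le>k. a k n)" using a_pos that by (intro member_le_sum) (auto intro: less_imp_le)
      then have "c k * a k n \<le> (1 / 2) ^ Suc k" by (intro c_le) (simp add: D_def)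
      then show ?thesis using c[of k] a_pos[of k n] by (simp add: abs_mult)
    qed
    then show "\<forall>\<^sub>F k in sequentially. norm (c k * a k n) \<le> (1 / 2) ^ Suc k"
      unfolding eventually_sequentially by blast
  qed
  define b where "b n = (\<Sum>k. c k * a k n)" for n
  have b_ge: "c k * a k n \<le> b n" for k n
  proof -
    have "sum (\<lambda>k. c k * a k n) {k} \<le> b n"
      unfolding b_def using c a_pos by (intro sum_le_suminf summ) (auto intro: less_imp_le)
    then show ?thesis by simp
  qed
  have b: "0 < b n" for n using b_ge[of 0 n] c[of 0] a_pos[of 0 n] by (meson less_le_trans mult_pos_pos)
  have "\<forall>x\<in>koethe_ball e a E q b. p (a k) x \<le> C / c k" for k
  proof
    fix x assume "x \<in> koethe_ball e a E q b"
    then have x: "x \<in> weighted_space b" "p b x \<le> 1" unfolding koethe_ball_iff by auto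
    have "\<bar>a k n * q n (x n)\<bar> \<le> \<bar>(1 / c k) * (b n * q n (x n))\<bar>" for n
    proof -
      have qn: "0 \<le> q n (x n)" by (rule q_nonneg[OF weighted_spaceD[OF x(1)]])
      have "a k n \<le> b n / c k" using b_ge[of k n] c[of k] by (simp add: field_simps)
      then have "a k n * q n (x n) \<le> b n / c k * q n (x n)" using qn by (rule mult_right_mono)
      then show ?thesis using qn a_pos[of k n] b[of n] c[of k] by (simp add: abs_mult)
    qed
    moreover have s: "(\<lambda>n. ((1 / c k) * (b n * q n (x n))) *\<^sub>R e n) sums ((1 / c k) *\<^sub>R (\<Sum>n. (b n * q n (x n)) *\<^sub>R e n))"
      using sums_scaleR_right[OF summable_sums[OF weighted_space_summable[OF x(1)]], of "1 / c k"] by simp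
    ultimately have "p (a k) x \<le> C * norm ((1 / c k) *\<^sub>R (\<Sum>n. (b n * q n (x n)) *\<^sub>R e n))"
      using dominated(2)[of x "a k" "\<lambda>n. (1 / c k) * (b n * q n (x n))", OF weighted_spaceD[OF x(1)] _ sums_summable[OF s]]
      unfolding sums_unique[OF s, symmetric] by blast
    also have "\<dots> = C / c k * p b x" using c[of k] by (simp add: p_eq)
    also have "\<dots> \<le> C / c k * 1" using x(2) C_ge_1 c[of k] by (intro mult_left_mono) auto
    finally show "p (a k) x \<le> C / c k" by simp
  qed
  then have "bounded_wrt (seq_scale s) (koethe_topology e a E q) (koethe_ball e a E q b)"
    unfolding bounded_iff using koethe_ball_iff by blast
  moreover have "B \<subseteq> koethe_ball e a E q b"
  proof
    fix x assume x: "x \<in> B"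
    then have xK: "x \<in> \<K>" using BK by blast
    define V where "V k = (\<Sum>n. (a k n * q n (x n)) *\<^sub>R e n)" for k
    have V_sums: "(\<lambda>n. (a k n * q n (x n)) *\<^sub>R e n) sums V k" for k
      unfolding V_def by (intro summable_sums weighted_space_summable koethe_space_subset xK)
    have V_le: "norm (c k *\<^sub>R V k) \<le> (1 / 2) ^ Suc k" for k
    proof -
      have "norm (V k) \<le> D k" using M[OF x, of k] a_sum[of k] by (simp add: p_eq V_def D_def)
      then show ?thesis using c_le[of "norm (V k)" k] c[of k] by simp
    qed
    have V_norm: "summable (\<lambda>k. norm (c k *\<^sub>R V k))"
      using V_le by (intro summable_comparison_test[OF _ sums_summable[OF half]]) auto
    have partial: "(\<lambda>n. ((\<Sum>k<j. c k * a k n) * q n (x n)) *\<^sub>R e n) sums (\<Sum>k<j. c k *\<^sub>R V k)" for j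
    proof -
      have "(\<lambda>n. \<Sum>k<j. c k *\<^sub>R (a k n * q n (x n)) *\<^sub>R e n) sums (\<Sum>k<j. c k *\<^sub>R V k)"
        by (intro sums_sum sums_scaleR_right V_sums)
      then show ?thesis by (simp add: sum_distrib_right scaleR_sum_left mult.assoc)
    qed
    have "(\<lambda>n. (b n * q n (x n)) *\<^sub>R e n) sums (\<Sum>k. c k *\<^sub>R V k)"
    proof (rule coefficient_limit_sums)
      show "summable (\<lambda>n. ((\<Sum>k<j. c k * a k n) * q n (x n)) *\<^sub>R e n)" for j
        using partial by (rule sums_summable)
      show "(\<lambda>j. \<Sum>n. ((\<Sum>k<j. c k * a k n) * q n (x n)) *\<^sub>R e n) \<longlonglongrightarrow> (\<Sum>k. c k *\<^sub>R V k)"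
        unfolding sums_unique[OF partial, symmetric]
        by (intro summable_LIMSEQ summable_norm_cancel[OF V_norm])
      show "(\<lambda>j. (\<Sum>k<j. c k * a k n) * q n (x n)) \<longlonglongrightarrow> b n * q n (x n)" for n
        unfolding b_def by (intro tendsto_mult_right summable_LIMSEQ summ)
    qed
    note b_sums = this
    have "p b x = norm (\<Sum>k. c k *\<^sub>R V k)" unfolding p_eq sums_unique[OF b_sums, symmetric] ..
    also have "\<dots> \<le> (\<Sum>k. norm (c k *\<^sub>R V k))" by (rule summable_norm[OF V_norm])
    also have "\<dots> \<le> (\<Sum>k. (1 / 2 :: real) ^ Suc k)"
      by (intro suminf_le V_le V_norm sums_summable[OF half])
    also have "\<dots> = 1" by (rule sums_unique[OF half, symmetric])
    finally have "p b x \<le> 1" .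
    moreover have "x \<in> weighted_space b"
      by (intro weighted_spaceI sums_summable[OF b_sums] weighted_spaceD[OF koethe_space_subset[OF xK]])
    ultimately show "x \<in> koethe_ball e a E q b" using xK by (simp add: koethe_ball_iff)
  qed
  ultimately show ?thesis using b by blast
qed

section \<open>The span of a bounded ball and the local Banach spaces\<close>

text \<open>
  The ball contains every sequence with a single non-zero entry and \<open>p b\<close> at most one. As \<open>p (a k)\<close> is
  bounded on the ball, \<open>a k n\<close> is at most a fixed multiple of \<open>b n\<close> at every \<open>n\<close> with \<open>E n\<close> non-trivial.
\<close>

lemma weighted_space_subset_koethe_space:
  assumes b: "\<And>n. 0 < b n"
    and bdd: "bounded_wrt (seq_scale s) (koethe_topology e a E q) (koethe_ball e a E q b)"
  shows "weighted_space b \<subseteq> \<K>"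
proof
  fix x assume x: "x \<in> weighted_space b"
  have "x \<in> weighted_space (a k)" for k
  proof -
    obtain M where M: "\<And>y. y \<in> koethe_ball e a E q b \<Longrightarrow> p (a k) y \<le> M"
      using bdd unfolding bounded_iff by blast
    have coef: "a k n * q n (x n) \<le> \<bar>M\<bar> * (b n * q n (x n))" for n
    proof (cases "x n = 0")
      case False
      have xn: "x n \<in> E n" by (rule weighted_spaceD[OF x])
      then have qn: "q n (x n) > 0" using q_nonneg[OF xn] q_eq_0_iff[OF xn] False by simp
      define d where "d = b n * q n (x n) * norm (e n)"
      have d: "d > 0" using b[of n] qn e_nonzero[of n] by (simp add: d_def)
      define y where "y = single n (s (of_real (1 / d)) (x n))"
      have z: "s (of_real (1 / d)) (x n) \<in> E n" by (rule E_scale[OF xn])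
      have qz: "q n (s (of_real (1 / d)) (x n)) = q n (x n) / d"
        using d unfolding q_scale[OF xn] norm_of_real by simp
      have "p b y = 1"
        unfolding y_def single_in_weighted_space(2)[OF z] qz using b[of n] qn e_nonzero[of n] by (simp add: d_def)
      then have "y \<in> koethe_ball e a E q b"
        unfolding koethe_ball_iff koethe_space_iff y_def using single_in_weighted_space(1)[OF z] by simp
      then have "p (a k) y \<le> \<bar>M\<bar>" using M by (meson abs_ge_self order_trans)
      then have *: "a k n * (q n (x n) / d) * norm (e n) \<le> \<bar>M\<bar>"
        unfolding y_def single_in_weighted_space(2)[OF z] qz using a_pos[of k n] by simp
      have "a k n * q n (x n) * norm (e n) \<le> \<bar>M\<bar> * (b n * q n (x n)) * norm (e n)"
      proof -
        have "a k n * (q n (x n) / d) * norm (e n) * d \<le> \<bar>M\<bar> * d"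
          using * d by (intro mult_right_mono) auto
        moreover have "a k n * (q n (x n) / d) * norm (e n) * d = a k n * q n (x n) * norm (e n)"
          using d by simp
        ultimately show ?thesis by (simp only: d_def mult.assoc)
      qed
      then show ?thesis by (rule mult_right_le_imp_le) (simp add: e_nonzero)
    qed (simp add: q_zero)
    have dom: "\<bar>a k n * q n (x n)\<bar> \<le> \<bar>\<bar>M\<bar> * (b n * q n (x n))\<bar>" for n
      using coef[of n] a_pos[of k n] b[of n] q_nonneg[OF weighted_spaceD[OF x], of n] by (simp add: abs_mult)
    have "summable (\<lambda>n. (\<bar>M\<bar> * (b n * q n (x n))) *\<^sub>R e n)"
      using summable_scaleR_right[OF weighted_space_summable[OF x], of "\<bar>M\<bar>"] by simp
    from dominated(1)[OF weighted_spaceD[OF x] dom this] show ?thesis .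
  qed
  then show "x \<in> \<K>" by (simp add: koethe_space_iff)
qed

context
  fixes b :: "nat \<Rightarrow> real"
  assumes b: "\<And>n. 0 < b n" and sub: "weighted_space b \<subseteq> \<K>"
begin

lemma in_dilated_koethe_ball_iff:
  assumes x: "x \<in> weighted_space b" and t: "0 < t"
  shows "x \<in> seq_scale s (of_real t) ` koethe_ball e a E q b \<longleftrightarrow> p b x \<le> t"
proof
  assume "x \<in> seq_scale s (of_real t) ` koethe_ball e a E q b"
  then obtain y where "y \<in> koethe_ball e a E q b" and yx: "x = seq_scale s (of_real t) y"
    by (rule imageE)
  then have y: "y \<in> weighted_space b" "p b y \<le> 1" unfolding koethe_ball_iff by auto
  have "p b x = t * p b y" unfolding yx weighted_space_scale(2)[OF b y(1)] using t by simp
  also have "\<dots> \<le> t * 1" using t y(2) by (intro mult_left_mono) auto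
  finally show "p b x \<le> t" by simp
next
  assume le: "p b x \<le> t"
  show "x \<in> seq_scale s (of_real t) ` koethe_ball e a E q b"
  proof
    show "x = seq_scale s (of_real t) (seq_scale s (of_real (1 / t)) x)"
      using t by (simp add: of_real_mult[symmetric] del: of_real_divide)
    have "p b (seq_scale s (of_real (1 / t)) x) \<le> 1"
      unfolding weighted_space_scale(2)[OF b x] norm_of_real using t le by simp
    then show "seq_scale s (of_real (1 / t)) x \<in> koethe_ball e a E q b"
      unfolding koethe_ball_iff using weighted_space_scale(1)[OF b x] sub by blast
  qed
qed

lemma minkowski_koethe_ball:
  assumes x: "x \<in> weighted_space b"
  shows "minkowski (seq_scale s) (koethe_ball e a E q b) x = p b x"
proof -
  have "{t. 0 < t \<and> x \<in> seq_scale s (of_real t) ` koethe_ball e a E q b} = {t. 0 < t \<and> p b x \<le> t}"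
    using in_dilated_koethe_ball_iff[OF x] by blast
  also have "Inf \<dots> = p b x"
  proof (rule cInf_eq_non_empty)
    have "p b x + 1 \<in> {t. 0 < t \<and> p b x \<le> t}" using p_nonneg[of b x] by simp
    then show "{t. 0 < t \<and> p b x \<le> t} \<noteq> {}" by blast
    fix y assume y: "\<And>t. t \<in> {t. 0 < t \<and> p b x \<le> t} \<Longrightarrow> y \<le> t"
    show "y \<le> p b x"
    proof (rule field_le_epsilon)
      fix \<epsilon> :: real assume "\<epsilon> > 0"
      then show "y \<le> p b x + \<epsilon>" using p_nonneg[of b x] by (intro y) simp
    qed
  qed simp
  finally show ?thesis unfolding minkowski_def .
qed

lemma span_koethe_ball: "seqs.span (koethe_ball e a E q b) = weighted_space b"
proof
  show "seqs.span (koethe_ball e a E q b) \<subseteq> weighted_space b"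
    using koethe_ball_iff by (intro seqs.span_minimal weighted_space_subspace b) blast
  show "weighted_space b \<subseteq> seqs.span (koethe_ball e a E q b)"
  proof
    fix x assume x: "x \<in> weighted_space b"
    have "x \<in> seq_scale s (of_real (p b x + 1)) ` koethe_ball e a E q b"
      using in_dilated_koethe_ball_iff[OF x, of "p b x + 1"] p_nonneg[of b x] by simp
    then obtain y where "y \<in> koethe_ball e a E q b" "x = seq_scale s (of_real (p b x + 1)) y"
      by (rule imageE)
    then show "x \<in> seqs.span (koethe_ball e a E q b)"
      by (metis seqs.span_base seqs.span_scale)
  qed
qed

end

context
  fixes k :: nat
begin

text \<open>
  The letters stand for the stages of the construction: \<open>Q\<close> is the quotient by the kernel of the
  \<open>k\<close>-th norm, \<open>CS\<close> the space of its Cauchy sequences, and \<open>W\<close> the concrete space that the completion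
  will be identified with.
\<close>

abbreviation "W \<equiv> weighted_space (a k)"
abbreviation "Q \<equiv> kernel_quotient (koethe_seminormed s e a E q k)"
abbreviation "CS \<equiv> cauchy_sequences Q"

lemma seminorm_eq_0_iff: "x \<in> \<K> \<Longrightarrow> p (a k) x = 0 \<longleftrightarrow> x = 0"
  by (rule p_eq_0_iff[OF a_pos koethe_space_subset])

lemma add_scale_minus_one: "x + seq_scale s (-1) y = x - y"
  by (auto simp: seq_scale_def)

text \<open>
  Since all \<open>a k n\<close> are positive, \<open>p (a k)\<close> separates points and the classes are singletons.
\<close>

lemma ker_rel_koethe: "ker_rel (koethe_seminormed s e a E q k) = Id_on \<K>"
proof -
  have "p (a k) (x - y) = 0 \<longleftrightarrow> x = y" if "x \<in> \<K>" "y \<in> \<K>" for x y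
    using seminorm_eq_0_iff[OF koethe_space_diff[OF that]] by simp
  then show ?thesis
    unfolding ker_rel_def vdiff_def koethe_seminormed_def by (auto simp: add_scale_minus_one)
qed

lemma pts_Q: "pts Q = (\<lambda>x. {x}) ` \<K>"
  unfolding kernel_quotient_def ker_rel_koethe by (auto simp: koethe_seminormed_def quotient_def)

lemma vadd_Q: "x \<in> \<K> \<Longrightarrow> y \<in> \<K> \<Longrightarrow> vadd Q {x} {y} = {x + y}"
  unfolding kernel_quotient_def ker_rel_koethe using koethe_space_add by (auto simp: koethe_seminormed_def)

lemma vscale_Q: "x \<in> \<K> \<Longrightarrow> vscale Q c {x} = {seq_scale s c x}"
  unfolding kernel_quotient_def ker_rel_koethe using koethe_space_scale by (auto simp: koethe_seminormed_def)

lemma vnorm_Q: "vnorm Q {x} = p (a k) x"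
  unfolding kernel_quotient_def by (simp add: koethe_seminormed_def)

lemma vdiff_Q: "x \<in> \<K> \<Longrightarrow> y \<in> \<K> \<Longrightarrow> vdiff Q {x} {y} = {x - y}"
  unfolding vdiff_def by (simp only: vscale_Q vadd_Q koethe_space_scale add_scale_minus_one)

text \<open>
  The equivalence class of Cauchy sequences that the completion assigns to the limit \<open>y\<close>.
\<close>

definition limit_class :: "(nat \<Rightarrow> 'b) \<Rightarrow> (nat \<Rightarrow> (nat \<Rightarrow> 'b) set) set" where
  "limit_class y = {F. \<exists>g. F = (\<lambda>i. {g i}) \<and> (\<forall>i. g i \<in> \<K>) \<and> (\<lambda>i. p (a k) (g i - y)) \<longlonglongrightarrow> 0}"

lemma pts_CS_iff:
  "(\<lambda>i. {g i}) \<in> pts CS \<longleftrightarrow> (\<forall>i. g i \<in> \<K>) \<and> (\<forall>\<epsilon>>0. \<exists>N. \<forall>i\<ge>N. \<forall>j\<ge>N. p (a k) (g i - g j) < \<epsilon>)"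
proof (cases "\<forall>i. g i \<in> \<K>")
  case True
  then show ?thesis by (simp add: cauchy_sequences_def pts_Q vdiff_Q vnorm_Q inj_image_mem_iff)
next
  case False
  then show ?thesis by (auto simp: cauchy_sequences_def pts_Q)
qed

lemma pts_CS_singletons: "F \<in> pts CS \<Longrightarrow> \<exists>g. F = (\<lambda>i. {g i})"
proof -
  assume "F \<in> pts CS"
  then have "\<forall>i. F i \<in> (\<lambda>x. {x}) ` \<K>" by (simp add: cauchy_sequences_def pts_Q)
  then have "\<forall>i. \<exists>x. F i = {x}" by blast
  from choice[OF this] show ?thesis by auto
qed

lemma limit_class_exists:
  assumes "F \<in> pts CS"
  shows "\<exists>y\<in>W. F \<in> limit_class y"
proof -
  obtain g where F: "F = (\<lambda>i. {g i})" using pts_CS_singletons[OF assms] by blast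
  have g: "\<And>i. g i \<in> \<K>" "\<And>\<epsilon>. \<epsilon> > 0 \<Longrightarrow> \<exists>N. \<forall>i\<ge>N. \<forall>j\<ge>N. p (a k) (g i - g j) < \<epsilon>"
    using assms unfolding F pts_CS_iff by auto
  obtain y where "y \<in> W" "(\<lambda>i. p (a k) (g i - y)) \<longlonglongrightarrow> 0"
    using weighted_space_complete[OF a_pos koethe_space_subset[OF g(1)] g(2)] by blast
  then show ?thesis unfolding limit_class_def F using g(1) by blast
qed

text \<open>
  Truncations of \<open>y\<close> belong to the Koethe space and converge to \<open>y\<close>.
\<close>

lemma limit_class_nonempty:
  assumes "y \<in> W"
  shows "\<exists>F. F \<in> limit_class y"
proof -
  have "truncation i y \<in> \<K>" for i
    unfolding koethe_space_iff by (intro allI truncation_in_weighted_space weighted_spaceD[OF assms])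
  then show ?thesis unfolding limit_class_def mem_Collect_eq
    by (intro exI[of _ "\<lambda>i. {truncation i y}"] exI[of _ "\<lambda>i. truncation i y"] conjI refl allI
        truncation_converges[OF assms])
qed

lemma limit_class_pts:
  assumes y: "y \<in> W" and F: "F \<in> limit_class y"
  shows "F \<in> pts CS"
proof -
  obtain g where g: "F = (\<lambda>i. {g i})" "\<And>i. g i \<in> \<K>" "(\<lambda>i. p (a k) (g i - y)) \<longlonglongrightarrow> 0"
    using F unfolding limit_class_def by auto
  have "\<exists>N. \<forall>i\<ge>N. \<forall>j\<ge>N. p (a k) (g i - g j) < \<epsilon>" if "\<epsilon> > 0" for \<epsilon>
  proof -
    have "\<epsilon> / (2 * C) > 0" using that C_ge_1 by simp
    from LIMSEQ_D[OF g(3) this] obtain N where N: "\<And>i. i \<ge> N \<Longrightarrow> p (a k) (g i - y) < \<epsilon> / (2 * C)"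
      using p_nonneg by auto
    have "p (a k) (g i - g j) < \<epsilon>" if "i \<ge> N" "j \<ge> N" for i j
    proof -
      have gW: "g i \<in> W" "g j \<in> W" using koethe_space_subset g(2) by auto
      have "p (a k) (g i - g j) \<le> C * (p (a k) (g i - y) + p (a k) (g j - y))"
        using p_triangle[OF a_pos gW(1) y gW(2)] p_minus_commute[OF a_pos y gW(2)] by simp
      also have "\<dots> < C * (\<epsilon> / (2 * C) + \<epsilon> / (2 * C))"
        using N[OF that(1)] N[OF that(2)] C_ge_1 by (intro mult_strict_left_mono add_strict_mono) auto
      also have "\<dots> = \<epsilon>" using C_ge_1 by simp
      finally show ?thesis .
    qed
    then show ?thesis by blast
  qed
  then show ?thesis unfolding g(1) pts_CS_iff using g(2) by blast
qed

lemma limit_class_vnorm: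
  assumes y: "y \<in> W" and F: "F \<in> limit_class y"
  shows "vnorm CS F = p (a k) y"
proof -
  obtain g where g: "F = (\<lambda>i. {g i})" "\<And>i. g i \<in> \<K>" "(\<lambda>i. p (a k) (g i - y)) \<longlonglongrightarrow> 0"
    using F unfolding limit_class_def by auto
  have "(\<lambda>i. p (a k) (g i) - p (a k) y) \<longlonglongrightarrow> 0"
    by (rule tendsto_zero_dominated[OF g(3)]) (rule p_Lipschitz[OF a_pos koethe_space_subset[OF g(2)] y])
  then have "(\<lambda>i. p (a k) (g i)) \<longlonglongrightarrow> p (a k) y" by (rule LIM_zero_cancel)
  then show ?thesis unfolding g(1) by (simp add: cauchy_sequences_def vnorm_Q limI)
qed

lemma limit_class_unique:
  assumes y: "y \<in> W" and z: "z \<in> W" and F: "F \<in> limit_class y" "F \<in> limit_class z"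
  shows "y = z"
proof -
  obtain g where g: "F = (\<lambda>i. {g i})" "\<And>i. g i \<in> \<K>" "(\<lambda>i. p (a k) (g i - y)) \<longlonglongrightarrow> 0"
    using F(1) unfolding limit_class_def by auto
  obtain h where h: "F = (\<lambda>i. {h i})" "(\<lambda>i. p (a k) (h i - z)) \<longlonglongrightarrow> 0"
    using F(2) unfolding limit_class_def by auto
  have "h i = g i" for i using fun_cong[OF trans[OF h(1)[symmetric] g(1)], of i] by simp
  then have gz: "(\<lambda>i. p (a k) (g i - z)) \<longlonglongrightarrow> 0" using h(2) by simp
  have gW: "g i \<in> W" for i using koethe_space_subset g(2) by auto
  have "(\<lambda>i. p (a k) (y - z)) \<longlonglongrightarrow> 0"
  proof (rule tendsto_zero_dominated)
    show "(\<lambda>i. p (a k) (g i - y) + p (a k) (g i - z)) \<longlonglongrightarrow> 0" using tendsto_add[OF g(3) gz] by simp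
    show "\<bar>p (a k) (y - z)\<bar> \<le> C * (p (a k) (g i - y) + p (a k) (g i - z))" for i
      using p_triangle[OF a_pos y gW z, of i] p_minus_commute[OF a_pos y gW, of i] p_nonneg[of "a k" "y - z"] by simp
  qed
  then have "p (a k) (y - z) = 0" by (simp add: LIMSEQ_const_iff)
  then show ?thesis using p_eq_0_iff[OF a_pos weighted_space_diff[OF a_pos y z]] by simp
qed

lemma limit_class_add:
  assumes y: "y \<in> W" and z: "z \<in> W" and F: "F \<in> limit_class y" and G: "G \<in> limit_class z"
  shows "vadd CS F G \<in> limit_class (y + z)"
proof -
  obtain g where g: "F = (\<lambda>i. {g i})" "\<And>i. g i \<in> \<K>" "(\<lambda>i. p (a k) (g i - y)) \<longlonglongrightarrow> 0"
    using F unfolding limit_class_def by auto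
  obtain h where h: "G = (\<lambda>i. {h i})" "\<And>i. h i \<in> \<K>" "(\<lambda>i. p (a k) (h i - z)) \<longlonglongrightarrow> 0"
    using G unfolding limit_class_def by auto
  have "(\<lambda>i. p (a k) ((g i + h i) - (y + z))) \<longlonglongrightarrow> 0"
  proof (rule tendsto_zero_dominated)
    show "(\<lambda>i. p (a k) (g i - y) + p (a k) (h i - z)) \<longlonglongrightarrow> 0" using tendsto_add[OF g(3) h(3)] by simp
    fix i
    have W: "g i - y \<in> W" "h i - z \<in> W"
      using weighted_space_diff[OF a_pos koethe_space_subset] g(2) h(2) y z by blast+
    have split: "(g i + h i) - (y + z) = (g i - y) + (h i - z)" by (simp add: algebra_simps)
    show "\<bar>p (a k) ((g i + h i) - (y + z))\<bar> \<le> C * (p (a k) (g i - y) + p (a k) (h i - z))"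
      unfolding split abs_of_nonneg[OF p_nonneg] by (rule weighted_space_add(2)[OF a_pos W])
  qed
  moreover have "vadd CS F G = (\<lambda>i. {g i + h i})"
    by (simp add: cauchy_sequences_def g(1) h(1) vadd_Q g(2) h(2))
  moreover have "g i + h i \<in> \<K>" for i by (rule koethe_space_add[OF g(2) h(2)])
  ultimately show ?thesis unfolding limit_class_def mem_Collect_eq by (intro exI[of _ "\<lambda>i. g i + h i"] conjI allI)
qed

lemma limit_class_scale:
  assumes y: "y \<in> W" and F: "F \<in> limit_class y"
  shows "vscale CS c F \<in> limit_class (seq_scale s c y)"
proof -
  obtain g where g: "F = (\<lambda>i. {g i})" "\<And>i. g i \<in> \<K>" "(\<lambda>i. p (a k) (g i - y)) \<longlonglongrightarrow> 0"
    using F unfolding limit_class_def by auto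
  have "p (a k) (seq_scale s c (g i) - seq_scale s c y) = norm c * p (a k) (g i - y)" for i
    using weighted_space_scale(2)[OF a_pos weighted_space_diff[OF a_pos koethe_space_subset[OF g(2)] y], of c i]
    by (simp only: seqs.scale_right_diff_distrib)
  then have "(\<lambda>i. p (a k) (seq_scale s c (g i) - seq_scale s c y)) \<longlonglongrightarrow> 0"
    using tendsto_mult_right_zero[OF g(3)] by simp
  moreover have "vscale CS c F = (\<lambda>i. {seq_scale s c (g i)})"
    by (simp add: cauchy_sequences_def g(1) vscale_Q g(2))
  moreover have "seq_scale s c (g i) \<in> \<K>" for i by (rule koethe_space_scale[OF g(2)])
  ultimately show ?thesis unfolding limit_class_def mem_Collect_eq
    by (intro exI[of _ "\<lambda>i. seq_scale s c (g i)"] conjI allI)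
qed

lemma ker_rel_CS:
  assumes y: "y \<in> W" and F: "F \<in> limit_class y"
  shows "ker_rel CS `` {F} = limit_class y"
proof -
  have "(F, G) \<in> ker_rel CS \<longleftrightarrow> G \<in> limit_class y" for G
  proof (cases "G \<in> pts CS")
    case True
    then obtain z where z: "z \<in> W" "G \<in> limit_class z" using limit_class_exists by blast
    have "vdiff CS F G \<in> limit_class (y + seq_scale s (-1) z)"
      unfolding vdiff_def
      by (intro limit_class_add limit_class_scale y F z weighted_space_scale(1)[OF a_pos])
    then have "vnorm CS (vdiff CS F G) = p (a k) (y - z)"
      unfolding add_scale_minus_one by (rule limit_class_vnorm[OF weighted_space_diff[OF a_pos y z(1)]])
    then have "vnorm CS (vdiff CS F G) = 0 \<longleftrightarrow> y = z"
      using p_eq_0_iff[OF a_pos weighted_space_diff[OF a_pos y z(1)]] by simp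
    moreover have "y = z \<longleftrightarrow> G \<in> limit_class y" using limit_class_unique[OF y z(1)] z(2) by blast
    ultimately show ?thesis unfolding ker_rel_def using True limit_class_pts[OF y F] by simp
  next
    case False
    then show ?thesis using limit_class_pts[OF y] by (auto simp: ker_rel_def)
  qed
  then show ?thesis by auto
qed

abbreviation "L \<equiv> local_banach_space s e a E q k"

lemma pts_L: "pts L = limit_class ` W"
proof -
  have "pts L = (\<lambda>F. ker_rel CS `` {F}) ` pts CS"
    unfolding local_banach_space_def completion_def by (subst kernel_quotient_def) (auto simp: quotient_def)
  also have "\<dots> = limit_class ` W"
  proof
    show "(\<lambda>F. ker_rel CS `` {F}) ` pts CS \<subseteq> limit_class ` W"
      using limit_class_exists ker_rel_CS by blast
    show "limit_class ` W \<subseteq> (\<lambda>F. ker_rel CS `` {F}) ` pts CS"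
    proof
      fix A assume "A \<in> limit_class ` W"
      then obtain y F where "y \<in> W" "A = limit_class y" "F \<in> limit_class y" using limit_class_nonempty by blast
      then show "A \<in> (\<lambda>F. ker_rel CS `` {F}) ` pts CS" using ker_rel_CS limit_class_pts by blast
    qed
  qed
  finally show ?thesis .
qed

lemma vadd_L:
  assumes y: "y \<in> W" and z: "z \<in> W"
  shows "vadd L (limit_class y) (limit_class z) = limit_class (y + z)"
proof -
  have "vadd L (limit_class y) (limit_class z)
      = (\<Union>F\<in>limit_class y. \<Union>G\<in>limit_class z. ker_rel CS `` {vadd CS F G})"
    unfolding local_banach_space_def completion_def by (subst kernel_quotient_def) simp
  also have "\<dots> = (\<Union>F\<in>limit_class y. \<Union>G\<in>limit_class z. limit_class (y + z))"
    using ker_rel_CS[OF weighted_space_add(1)[OF a_pos y z] limit_class_add[OF y z]] by simp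
  also have "\<dots> = limit_class (y + z)" using limit_class_nonempty[OF y] limit_class_nonempty[OF z] by blast
  finally show ?thesis .
qed

lemma vscale_L:
  assumes y: "y \<in> W"
  shows "vscale L c (limit_class y) = limit_class (seq_scale s c y)"
proof -
  have "vscale L c (limit_class y) = (\<Union>F\<in>limit_class y. ker_rel CS `` {vscale CS c F})"
    unfolding local_banach_space_def completion_def by (subst kernel_quotient_def) simp
  also have "\<dots> = (\<Union>F\<in>limit_class y. limit_class (seq_scale s c y))"
    using ker_rel_CS[OF weighted_space_scale(1)[OF a_pos y] limit_class_scale[OF y]] by simp
  also have "\<dots> = limit_class (seq_scale s c y)" using limit_class_nonempty[OF y] by blast
  finally show ?thesis .
qed

lemma vnorm_L:
  assumes y: "y \<in> W"
  shows "vnorm L (limit_class y) = p (a k) y"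
proof -
  have "vnorm L (limit_class y) = the_elem (vnorm CS ` limit_class y)"
    unfolding local_banach_space_def completion_def by (subst kernel_quotient_def) simp
  also have "vnorm CS ` limit_class y = {p (a k) y}"
    using limit_class_vnorm[OF y] limit_class_nonempty[OF y] by auto
  finally show ?thesis by simp
qed

text \<open>
  The isometry multiplies coordinates by \<open>b n / a k n\<close>, which turns the weight \<open>a k\<close> into \<open>b\<close>, and then
  passes to the class of the Cauchy sequences with that limit.
\<close>

lemma isometric_span_koethe_ball:
  assumes b: "\<And>n. 0 < b n"
    and bdd: "bounded_wrt (seq_scale s) (koethe_topology e a E q) (koethe_ball e a E q b)"
  shows "isometric (span_space (seq_scale s) (koethe_ball e a E q b)) L"
proof -
  note sub = weighted_space_subset_koethe_space[OF b bdd]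
  define \<rho> where "\<rho> v x = (\<lambda>n. s (of_real (v n)) (x n))" for v :: "nat \<Rightarrow> real" and x :: "nat \<Rightarrow> 'b"
  have \<rho>: "\<rho> (\<lambda>n. u n / v n) x \<in> weighted_space v \<and> p v (\<rho> (\<lambda>n. u n / v n) x) = p u x"
    if x: "x \<in> weighted_space u" and uv: "\<And>n. 0 < u n" "\<And>n. 0 < v n" for u v x
  proof -
    have "v n * q n (\<rho> (\<lambda>n. u n / v n) x n) = u n * q n (x n)" for n
      using uv[of n] unfolding \<rho>_def q_scale[OF weighted_spaceD[OF x]] norm_of_real by simp
    then show ?thesis
      using weighted_space_summable[OF x] weighted_spaceD[OF x] E_scale
      by (auto simp: p_eq \<rho>_def intro!: weighted_spaceI)
  qed
  have inv: "\<rho> (\<lambda>n. u n / v n) (\<rho> (\<lambda>n. v n / u n) x) = x" if "\<And>n. 0 < u n" "\<And>n. 0 < v n" for u v x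
  proof
    fix n
    have "(of_real (u n / v n) * of_real (v n / u n) :: 'k) = of_real ((u n / v n) * (v n / u n))"
      by (simp only: of_real_mult)
    also have "\<dots> = 1" using that[of n] by simp
    finally show "\<rho> (\<lambda>n. u n / v n) (\<rho> (\<lambda>n. v n / u n) x) n = x n"
      by (simp only: \<rho>_def scale_scale scale_one)
  qed
  define r where "r = \<rho> (\<lambda>n. b n / a k n)"
  have rW: "r x \<in> W" "p (a k) (r x) = p b x" if "x \<in> weighted_space b" for x
    using \<rho>[OF that b a_pos[of k]] by (simp_all add: r_def)
  have r_bij: "bij_betw r (weighted_space b) W"
  proof (rule bij_betw_byWitness[of _ "\<rho> (\<lambda>n. a k n / b n)"])
    show "\<forall>x\<in>weighted_space b. \<rho> (\<lambda>n. a k n / b n) (r x) = x"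
      unfolding r_def using inv[of "a k" b, OF a_pos b] by blast
    show "\<forall>x\<in>W. r (\<rho> (\<lambda>n. a k n / b n) x) = x"
      unfolding r_def using inv[of b "a k", OF b a_pos] by blast
    show "r ` weighted_space b \<subseteq> W" using rW by blast
    show "\<rho> (\<lambda>n. a k n / b n) ` W \<subseteq> weighted_space b" using \<rho>[of _ "a k" b, OF _ a_pos b] by blast
  qed
  have r_add: "r (x + y) = r x + r y" for x y
    by (auto simp: r_def \<rho>_def scale_right_distrib)
  have r_scale: "r (seq_scale s c x) = seq_scale s c (r x)" for c x
    by (simp add: r_def \<rho>_def seq_scale_def mult.commute)
  have "bij_betw limit_class W (pts L)"
    unfolding bij_betw_def pts_L using limit_class_unique limit_class_nonempty
    by (intro conjI inj_onI refl) blast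
  then have bij: "bij_betw (limit_class \<circ> r) (weighted_space b) (pts L)"
    by (rule bij_betw_trans[OF r_bij])
  show ?thesis
    unfolding isometric_def
  proof (intro exI[of _ "limit_class \<circ> r"] conjI ballI allI)
    note S = span_space_def span_koethe_ball[OF b sub]
    show "bij_betw (limit_class \<circ> r) (pts (span_space (seq_scale s) (koethe_ball e a E q b))) (pts L)"
      using bij by (simp add: S)
    fix x assume "x \<in> pts (span_space (seq_scale s) (koethe_ball e a E q b))"
    then have x: "x \<in> weighted_space b" by (simp add: S)
    show "(limit_class \<circ> r) (vscale (span_space (seq_scale s) (koethe_ball e a E q b)) c x)
        = vscale L c ((limit_class \<circ> r) x)" for c
      using rW[OF x] by (simp add: S r_scale vscale_L)
    show "vnorm L ((limit_class \<circ> r) x) = vnorm (span_space (seq_scale s) (koethe_ball e a E q b)) x"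
      using rW[OF x] minkowski_koethe_ball[OF b sub x] by (simp add: S vnorm_L)
    fix y assume "y \<in> pts (span_space (seq_scale s) (koethe_ball e a E q b))"
    then have y: "y \<in> weighted_space b" by (simp add: S)
    show "(limit_class \<circ> r) (vadd (span_space (seq_scale s) (koethe_ball e a E q b)) x y)
        = vadd L ((limit_class \<circ> r) x) ((limit_class \<circ> r) y)"
      using rW[OF x] rW[OF y] by (simp add: S r_add vadd_L)
  qed
qed

end
end

theorem proposition4p1:
  fixes sX :: "'k::real_normed_field \<Rightarrow> 'x::banach \<Rightarrow> 'x"
    and e :: "nat \<Rightarrow> 'x"
    and a :: "nat \<Rightarrow> nat \<Rightarrow> real"
    and s :: "'k \<Rightarrow> 'b::ab_group_add \<Rightarrow> 'b"
    and E :: "nat \<Rightarrow> 'b set"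
    and q :: "nat \<Rightarrow> 'b \<Rightarrow> real"
  assumes "normed_scaling sX"
    and "unconditional_basis sX e"
    and "koethe_matrix a"
    and "\<And>k n. 0 < a k n"
    and "vector_space s"
    and "\<And>n. banach_space_on s (E n) (q n)"
  shows "(\<forall>B. bounded_wrt (seq_scale s) (koethe_topology e a E q) B \<longrightarrow>
            (\<exists>b. (\<forall>n. 0 < b n) \<and>
                 bounded_wrt (seq_scale s) (koethe_topology e a E q) (koethe_ball e a E q b) \<and>
                 B \<subseteq> koethe_ball e a E q b)) \<and>
         (\<forall>b. (\<forall>n. 0 < b n) \<and>
              bounded_wrt (seq_scale s) (koethe_topology e a E q) (koethe_ball e a E q b) \<longrightarrow>
            (\<forall>k. isometric (span_space (seq_scale s) (koethe_ball e a E q b))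
                   (local_banach_space s e a E q k)))"
proof -
  interpret X: unconditional_basis_space sX e
    by (intro unconditional_basis_space.intro assms)
  obtain C where C: "C \<ge> 1" and solid: "\<And>u v. (\<And>n. \<bar>u n\<bar> \<le> \<bar>v n\<bar>) \<Longrightarrow> summable (\<lambda>n. v n *\<^sub>R e n) \<Longrightarrow>
      summable (\<lambda>n. u n *\<^sub>R e n) \<and> norm (\<Sum>n. u n *\<^sub>R e n) \<le> C * norm (\<Sum>n. v n *\<^sub>R e n)"
    using X.solid_norm_constant by blast
  interpret koethe_sequence_space e C s E q a
    using C X.basis_nonzero solid assms(4-6)
    by (intro koethe_sequence_space.intro weighted_sequence_spaces.intro koethe_sequence_space_axioms.intro) auto
  show ?thesis
    using bounded_subset_koethe_ball isometric_span_koethe_ball by blast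
qed

end
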